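(* Let $0<p<1$ be fixed, let $G=B(n_1,n_2,p)$ be the random bipartite graph with $n=n_1+n_2$ vertices, and let $N(n_1,n_2)$ be the number of groupies in $G$. Then for every $\epsilon>0$ and every fixed $c\in\mathbb{Z}$, $$P\left(\left|\frac{N(n_1,n_2)}{n}-\frac12\left(\Phi\left(1+\frac{pc}{2(1-p)}\right)+\Phi\left(1-\frac{pc}{2(1-p)}\right)\right)\right|>\epsilon\right)\longrightarrow 0$$ as $n_1,n_2\to\infty$ with $n_1-n_2=c$, where $\Phi$ is the cumulative distribution function of the standard normal distribution $N(0,1)$.
   Context: $B(n_1,n_2,p)$ denotes the random bipartite graph with parts $P_1,P_2$ of sizes $n_1,n_2$ in which each of the $n_1n_2$ possible edges between $P_1$ and $P_2$ is present independently with probability $p$ (and there are no other edges). Groupie: let $G=(V,E)$ be a simple graph with $|V|=n$ and $|E|=e$. For $v\in V$ let $r(v)$ be the sum of the degrees of the neighbors of $v$. A non-isolated vertex $v$ is a groupie if the average degree of its neighbors is not less than the average degree of all vertices of $G$, i.e. $\frac{r(v)}{\deg(v)}\ge\frac{2e}{n}$. An isolated vertex $v$ is a groupie if and only if all vertices of $G$ are isolated. *)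

theory Defs
  imports "HOL-Probability.Probability"
begin

definition simple_graph :: "'a set \<Rightarrow> 'a set set \<Rightarrow> bool" where
  "simple_graph V E \<longleftrightarrow> finite V \<and> (\<forall>e\<in>E. e \<subseteq> V \<and> card e = 2)"

definition nbrs :: "'a set set \<Rightarrow> 'a \<Rightarrow> 'a set" where
  "nbrs E v = {u. {u, v} \<in> E}"

definition deg :: "'a set set \<Rightarrow> 'a \<Rightarrow> nat" where
  "deg E v = card (nbrs E v)"

definition nbr_deg_sum :: "'a set set \<Rightarrow> 'a \<Rightarrow> nat" where
  "nbr_deg_sum E v = (\<Sum>u\<in>nbrs E v. deg E u)"

definition groupie :: "'a set \<Rightarrow> 'a set set \<Rightarrow> 'a \<Rightarrow> bool" where
  "groupie V E v \<longleftrightarrow> v \<in> V \<and>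
     (if deg E v = 0 then \<forall>u\<in>V. deg E u = 0
      else real (nbr_deg_sum E v) / real (deg E v) \<ge> 2 * real (card E) / real (card V))"

definition num_groupies :: "'a set \<Rightarrow> 'a set set \<Rightarrow> nat" where
  "num_groupies V E = card {v \<in> V. groupie V E v}"

definition bip_verts :: "nat \<Rightarrow> nat \<Rightarrow> (nat + nat) set" where
  "bip_verts n1 n2 = {..<n1} <+> {..<n2}"

definition bip_pairs :: "nat \<Rightarrow> nat \<Rightarrow> (nat + nat) set set" where
  "bip_pairs n1 n2 = {{Inl i, Inr j} | i j. i < n1 \<and> j < n2}"

text \<open>The law of the edge set of $B(n_1,n_2,p)$ on the vertex set \<open>bip_verts n1 n2\<close>: each pair in
  \<open>bip_pairs n1 n2\<close> carries an independent Bernoulli variable, and the edges are the pairs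
  whose variable is \<open>True\<close>.\<close>

definition random_bipartite :: "nat \<Rightarrow> nat \<Rightarrow> real \<Rightarrow> (nat + nat) set set pmf" where
  "random_bipartite n1 n2 p =
     map_pmf (\<lambda>\<omega>. {e \<in> bip_pairs n1 n2. \<omega> e})
       (Pi_pmf (bip_pairs n1 n2) False (\<lambda>_. bernoulli_pmf p))"

lemma simple_graph_random_bipartite:
  assumes "E \<in> set_pmf (random_bipartite n1 n2 p)"
  shows "simple_graph (bip_verts n1 n2) E"
  using assms
  by (auto simp: random_bipartite_def simple_graph_def bip_verts_def bip_pairs_def)

definition std_normal_cdf :: "real \<Rightarrow> real" where
  "std_normal_cdf = cdf std_normal_distribution"

end

(*
  Fix two left vertices v, v' and condition on the numbers C j of neighbours that each right vertex j
  has among the other left vertices. The rows A, B of v, v' are then independent Bernoulli rows, and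
  v is a groupie iff the linear statistic
      sum_j (mean C - C j) (A j - p) / (m p (1 - p))
  is at most a threshold that depends only on averages of A, B, A B and C, and which tends to
  1 + p c / (2 (1 - p)). The number of edges fluctuates on the same scale as the average degree of
  the neighbours of v, but centring C at its mean removes it. For typical C the statistic is
  asymptotically standard normal by the Lindeberg condition, so the indicators of "v is a groupie" are
  asymptotically uncorrelated and Chebyshev's inequality applies to the left part. The right part
  follows by exchanging the sides, which replaces c by -c.
*)

theory Submission
  imports Defs
begin

section \<open>Products of probability mass functions\<close>

text \<open>Why the limit has this shape: let e be the number of edges and n = k + m. A left vertex
  has about m p neighbours, and each of them already counts that vertex in its degree. Their average
  degree therefore exceeds the average right degree e/m by about 1 - p, and its fluctuation has
  standard deviation about 1 - p too; the quotient is the 1 inside \<Phi>. The benchmark 2e/n equals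
  e/m - e c / (m n), a shift of about p c / 2, and dividing by 1 - p gives the other summand. Two
  obstacles shape the proof. The weights of the statistic are random, so the normal approximation
  has to hold uniformly over all good weights instead of along one given sequence. And the threshold
  for v involves the rows of both v and v', so the two groupie events are not independent given the
  column counts. Replacing the threshold by its limit restores this independence; the replacement
  matters only if the statistic falls into a small window around the limit, which the normal
  approximation and the continuity of \<Phi> make unlikely.\<close>

lemma Pi_pmf_Times:
  assumes "finite I" "finite J"
  shows "map_pmf (\<lambda>f j i. f (i, j)) (Pi_pmf (I \<times> J) d (\<lambda>_. P)) =
         Pi_pmf J (\<lambda>_. d) (\<lambda>_. Pi_pmf I d (\<lambda>_. P))"
proof (rule pmf_eqI)
  fix F :: "'b \<Rightarrow> 'a \<Rightarrow> 'c"
  let ?g = "\<lambda>f j i. f (i, j) :: 'c"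
  have inj: "inj ?g"
    by (auto simp: inj_def fun_eq_iff)
  have F: "F = ?g (\<lambda>(i, j). F j i)" by simp
  have "pmf (map_pmf ?g (Pi_pmf (I \<times> J) d (\<lambda>_. P))) F = pmf (Pi_pmf (I \<times> J) d (\<lambda>_. P)) (\<lambda>(i, j). F j i)"
    by (subst F, rule pmf_map_inj'[OF inj])
  also have "\<dots> = pmf (Pi_pmf J (\<lambda>_. d) (\<lambda>_. Pi_pmf I d (\<lambda>_. P))) F"
  proof (cases "\<forall>i j. (i, j) \<notin> I \<times> J \<longrightarrow> F j i = d")
    case True
    have "pmf (Pi_pmf (I \<times> J) d (\<lambda>_. P)) (\<lambda>(i, j). F j i) = (\<Prod>(i, j)\<in>I \<times> J. pmf P (F j i))"
      using True assms by (subst pmf_Pi') (auto intro!: prod.cong)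
    also have "\<dots> = (\<Prod>j\<in>J. \<Prod>i\<in>I. pmf P (F j i))"
      by (subst prod.cartesian_product[symmetric]) (rule prod.swap)
    also have "\<dots> = (\<Prod>j\<in>J. pmf (Pi_pmf I d (\<lambda>_. P)) (F j))"
      using True assms by (intro prod.cong refl) (subst pmf_Pi', auto)
    also have "\<dots> = pmf (Pi_pmf J (\<lambda>_. d) (\<lambda>_. Pi_pmf I d (\<lambda>_. P))) F"
      using True assms by (subst pmf_Pi') (auto simp: fun_eq_iff)
    finally show ?thesis .
  next
    case False
    then obtain i j where ij: "(i, j) \<notin> I \<times> J" "F j i \<noteq> d" by blast
    have "pmf (Pi_pmf (I \<times> J) d (\<lambda>_. P)) (\<lambda>(i, j). F j i) = 0"
      using ij assms by (intro pmf_Pi_outside) auto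
    moreover have "pmf (Pi_pmf J (\<lambda>_. d) (\<lambda>_. Pi_pmf I d (\<lambda>_. P))) F = 0"
    proof (cases "j \<in> J")
      case True
      then have "pmf (Pi_pmf I d (\<lambda>_. P)) (F j) = 0"
        using ij assms by (intro pmf_Pi_outside) auto
      then show ?thesis using assms True by (subst pmf_Pi) (auto intro!: prod_zero)
    next
      case False
      then show ?thesis using ij assms by (intro pmf_Pi_outside) (auto simp: fun_eq_iff)
    qed
    ultimately show ?thesis by simp
  qed
  finally show "pmf (map_pmf ?g (Pi_pmf (I \<times> J) d (\<lambda>_. P))) F =
    pmf (Pi_pmf J (\<lambda>_. d) (\<lambda>_. Pi_pmf I d (\<lambda>_. P))) F" .
qed

lemma Pi_pmf_pair_pmf:
  assumes "finite A"
  shows "map_pmf (\<lambda>h. (\<lambda>x. fst (h x), \<lambda>x. snd (h x))) (Pi_pmf A (d, e) (\<lambda>x. pair_pmf (P x) (Q x))) =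
         pair_pmf (Pi_pmf A d P) (Pi_pmf A e Q)"
proof (rule pmf_eqI, clarify)
  fix f :: "'a \<Rightarrow> 'b" and g :: "'a \<Rightarrow> 'c"
  let ?u = "\<lambda>h. (\<lambda>x. fst (h x), \<lambda>x. snd (h x)) :: ('a \<Rightarrow> 'b) \<times> ('a \<Rightarrow> 'c)"
  have inj: "inj ?u"
    by (auto simp: inj_def fun_eq_iff prod_eq_iff)
  have fg: "(f, g) = ?u (\<lambda>x. (f x, g x))" by simp
  have "pmf (map_pmf ?u (Pi_pmf A (d, e) (\<lambda>x. pair_pmf (P x) (Q x)))) (f, g) =
        pmf (Pi_pmf A (d, e) (\<lambda>x. pair_pmf (P x) (Q x))) (\<lambda>x. (f x, g x))"
    by (subst fg, rule pmf_map_inj'[OF inj])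
  also have "\<dots> = pmf (pair_pmf (Pi_pmf A d P) (Pi_pmf A e Q)) (f, g)"
    using assms by (auto simp: pmf_Pi pmf_pair prod.distrib)
  finally show "pmf (map_pmf ?u (Pi_pmf A (d, e) (\<lambda>x. pair_pmf (P x) (Q x)))) (f, g) =
    pmf (pair_pmf (Pi_pmf A d P) (Pi_pmf A e Q)) (f, g)" .
qed

text \<open>The discrete laws below are finite products of Bernoulli and binomial laws, so they have
  finite support; this settles integrability and turns expectations into finite sums.\<close>

lemma finite_set_Pi_pmf [intro]:
  assumes "finite A" "\<And>x. x \<in> A \<Longrightarrow> finite (set_pmf (P x))"
  shows "finite (set_pmf (Pi_pmf A d P))"
  using assms by (simp add: set_Pi_pmf finite_PiE_dflt)

lemma expectation_pair_pmf:
  fixes f :: "'a \<times> 'b \<Rightarrow> real"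
  assumes "finite (set_pmf P)" "finite (set_pmf Q)"
  shows "measure_pmf.expectation (pair_pmf P Q) f =
         measure_pmf.expectation P (\<lambda>x. measure_pmf.expectation Q (\<lambda>y. f (x, y)))"
proof -
  have "measure_pmf.expectation (pair_pmf P Q) f =
        (\<Sum>z\<in>set_pmf P \<times> set_pmf Q. pmf (pair_pmf P Q) z * f z)"
    using assms by (subst integral_measure_pmf[of "set_pmf P \<times> set_pmf Q"]) auto
  also have "\<dots> = (\<Sum>x\<in>set_pmf P. \<Sum>y\<in>set_pmf Q. pmf P x * (pmf Q y * f (x, y)))"
    by (subst sum.cartesian_product) (auto intro!: sum.cong simp: pmf_pair)
  also have "\<dots> = measure_pmf.expectation P (\<lambda>x. measure_pmf.expectation Q (\<lambda>y. f (x, y)))"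
    using assms by (simp add: integral_measure_pmf[of "set_pmf P"]
        integral_measure_pmf[of "set_pmf Q"] sum_distrib_left)
  finally show ?thesis .
qed

lemma pmf_Markov:
  assumes "finite (set_pmf P)" "\<And>x. f x \<ge> 0" "t > 0"
  shows "measure_pmf.prob P {x. f x \<ge> t} \<le> measure_pmf.expectation P f / t"
  using integral_Markov_inequality_measure[of P f UNIV t] assms
  by (simp add: integrable_measure_pmf_finite)

text \<open>Conditioning on the first component: off \<open>S\<close> the conditional probability is
  bounded by 1, on \<open>S\<close> by \<open>\<alpha>\<close>. In the applications \<open>S\<close>
  is a set of typical first components.\<close>

lemma prob_pair_pmf_le:
  fixes \<alpha> :: real
  assumes "finite (set_pmf P)" "finite (set_pmf Q)" "\<alpha> \<ge> 0"
    and "\<And>x. x \<in> S \<Longrightarrow> measure_pmf.prob Q {y. (x, y) \<in> R} \<le> \<alpha>"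
  shows "measure_pmf.prob (pair_pmf P Q) R \<le> measure_pmf.prob P (- S) + \<alpha>"
proof -
  have "measure_pmf.prob (pair_pmf P Q) R = measure_pmf.expectation (pair_pmf P Q) (indicator R)"
    by simp
  also have "\<dots> = measure_pmf.expectation P (\<lambda>x. measure_pmf.prob Q {y. (x, y) \<in> R})"
  proof -
    have "indicator R (x, y) = (indicator {y. (x, y) \<in> R} y :: real)" for x y
      by (simp add: indicator_def)
    then show ?thesis
      using assms by (subst expectation_pair_pmf) auto
  qed
  also have "\<dots> \<le> measure_pmf.expectation P (\<lambda>x. indicator (- S) x + \<alpha>)"
    using assms by (intro integral_mono integrable_measure_pmf_finite)
      (auto simp: indicator_def intro: order_trans[OF measure_pmf.prob_le_1])
  also have "\<dots> = measure_pmf.prob P (- S) + \<alpha>"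
    using assms by (subst Bochner_Integration.integral_add) (auto simp: integrable_measure_pmf_finite)
  finally show ?thesis .
qed

text \<open>One induction serves all three claims, because splitting off a coordinate in the fourth
  power uses the mean and the variance of the shorter sum. The cross terms with a first power vanish
  by independence and centring, so no third moment has to be known.\<close>

lemma Pi_pmf_moments:
  fixes f :: "'a \<Rightarrow> 'b \<Rightarrow> real"
  assumes "finite A" "\<And>x. x \<in> A \<Longrightarrow> finite (set_pmf (P x))"
    and "\<And>x. x \<in> A \<Longrightarrow> measure_pmf.expectation (P x) (f x) = 0"
  shows expectation_sum_centered:
      "measure_pmf.expectation (Pi_pmf A d P) (\<lambda>g. \<Sum>x\<in>A. f x (g x)) = 0"
    and variance_sum_centered:
      "measure_pmf.expectation (Pi_pmf A d P) (\<lambda>g. (\<Sum>x\<in>A. f x (g x))\<^sup>2) =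
       (\<Sum>x\<in>A. measure_pmf.expectation (P x) (\<lambda>y. (f x y)\<^sup>2))"
    and fourth_moment_sum_centered:
      "(\<And>x y. x \<in> A \<Longrightarrow> \<bar>f x y\<bar> \<le> 1) \<Longrightarrow>
       measure_pmf.expectation (Pi_pmf A d P) (\<lambda>g. (\<Sum>x\<in>A. f x (g x)) ^ 4) \<le> 3 * (real (card A))\<^sup>2"
proof -
  let ?E = measure_pmf.expectation
  let ?S = "\<lambda>A g. \<Sum>x\<in>A. f x (g x)"
  have "?E (Pi_pmf A d P) (?S A) = 0 \<and>
    ?E (Pi_pmf A d P) (\<lambda>g. (?S A g)\<^sup>2) = (\<Sum>x\<in>A. ?E (P x) (\<lambda>y. (f x y)\<^sup>2)) \<and>
    ((\<forall>x\<in>A. \<forall>y. \<bar>f x y\<bar> \<le> 1) \<longrightarrow> ?E (Pi_pmf A d P) (\<lambda>g. (?S A g) ^ 4) \<le> 3 * (real (card A))\<^sup>2)"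
    using assms
  proof (induction A rule: finite_induct)
    case empty
    then show ?case by simp
  next
    case (insert x A)
    define Q where "Q = Pi_pmf A d P"
    have fin: "finite (set_pmf (P x))" "finite (set_pmf Q)"
      unfolding Q_def using insert by auto
    note int = integrable_measure_pmf_finite[OF fin(1)] integrable_measure_pmf_finite[OF fin(2)]
    have split: "?E (Pi_pmf (insert x A) d P) (\<lambda>g. \<phi> (?S (insert x A) g)) =
          ?E (P x) (\<lambda>y. ?E Q (\<lambda>g. \<phi> (f x y + ?S A g)))" for \<phi> :: "real \<Rightarrow> real"
    proof -
      have *: "?S (insert x A) (g(x := y)) = f x y + ?S A g" for g y
        using insert.hyps by (auto intro!: sum.cong)
      show ?thesis
        unfolding Q_def using insert fin
        by (simp add: Pi_pmf_insert case_prod_beta expectation_pair_pmf * Q_def del: sum.insert fun_upd_apply)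
    qed
    have IH: "?E Q (?S A) = 0" "?E Q (\<lambda>g. (?S A g)\<^sup>2) = (\<Sum>x\<in>A. ?E (P x) (\<lambda>y. (f x y)\<^sup>2))"
      "(\<forall>x\<in>A. \<forall>y. \<bar>f x y\<bar> \<le> 1) \<Longrightarrow> ?E Q (\<lambda>g. (?S A g) ^ 4) \<le> 3 * (real (card A))\<^sup>2"
      using insert unfolding Q_def by auto
    have fx: "?E (P x) (f x) = 0" using insert by simp
    have 1: "?E (Pi_pmf (insert x A) d P) (?S (insert x A)) = 0"
      using split[of "\<lambda>z. z"] fx IH by (simp add: int)
    have 2: "?E (Pi_pmf (insert x A) d P) (\<lambda>g. (?S (insert x A) g)\<^sup>2) =
        ?E (P x) (\<lambda>y. (f x y)\<^sup>2) + (\<Sum>x\<in>A. ?E (P x) (\<lambda>y. (f x y)\<^sup>2))"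
      using split[of "\<lambda>z. z\<^sup>2"] fx IH by (simp add: int power2_sum mult.assoc)
    have 3: "?E (Pi_pmf (insert x A) d P) (\<lambda>g. (?S (insert x A) g) ^ 4) \<le> 3 * (real (card (insert x A)))\<^sup>2"
      if b: "\<forall>z\<in>insert x A. \<forall>y. \<bar>f z y\<bar> \<le> 1"
    proof -
      have e: "(u + v) ^ 4 = u ^ 4 + 4 * (u ^ 3 * v) + 6 * (u\<^sup>2 * v\<^sup>2) + 4 * (u * v ^ 3) + v ^ 4" for u v :: real
        by algebra
      have "?E (Pi_pmf (insert x A) d P) (\<lambda>g. (?S (insert x A) g) ^ 4) =
          ?E (P x) (\<lambda>y. (f x y) ^ 4) + 6 * (?E (P x) (\<lambda>y. (f x y)\<^sup>2) * ?E Q (\<lambda>g. (?S A g)\<^sup>2))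
          + ?E Q (\<lambda>g. (?S A g) ^ 4)"
        using split[of "\<lambda>z. z ^ 4"] fx IH(1) by (simp add: int e)
      \<comment> \<open>The constant 3 closes the induction, since 1 + 6 n + 3 n^2 \<le> 3 (n +
        1)^2.\<close>
      also have "\<dots> \<le> 1 + 6 * (1 * real (card A)) + 3 * (real (card A))\<^sup>2"
      proof (intro add_mono mult_left_mono mult_mono)
        have le1: "?E (P z) (\<lambda>y. (f z y) ^ n) \<le> 1" if "z \<in> insert x A" for z n
        proof -
          have "?E (P z) (\<lambda>y. (f z y) ^ n) \<le> ?E (P z) (\<lambda>y. 1)"
          proof (intro integral_mono integrable_measure_pmf_finite)
            fix y
            have "(f z y) ^ n \<le> \<bar>f z y\<bar> ^ n" by (simp add: power_abs[symmetric])
            also have "\<dots> \<le> 1" using b that by (intro power_le_one) auto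
            finally show "(f z y) ^ n \<le> 1" .
          qed (use that insert in auto)
          then show ?thesis by simp
        qed
        show "?E (P x) (\<lambda>y. (f x y) ^ 4) \<le> 1" "?E (P x) (\<lambda>y. (f x y)\<^sup>2) \<le> 1" using le1 by auto
        show "?E Q (\<lambda>g. (?S A g)\<^sup>2) \<le> real (card A)"
          unfolding IH(2) using le1 by (auto intro!: order_trans[OF sum_bounded_above[of A _ 1]])
        show "?E Q (\<lambda>g. (?S A g) ^ 4) \<le> 3 * (real (card A))\<^sup>2" using IH(3) b by auto
      qed auto
      also have "\<dots> \<le> 3 * (real (card (insert x A)))\<^sup>2"
        using insert by (simp add: power2_eq_square algebra_simps)
      finally show ?thesis .
    qed
    show ?case using 1 2 3 insert by simp
  qed
  then show "?E (Pi_pmf A d P) (?S A) = 0"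
    and "?E (Pi_pmf A d P) (\<lambda>g. (?S A g)\<^sup>2) = (\<Sum>x\<in>A. ?E (P x) (\<lambda>y. (f x y)\<^sup>2))"
    and "(\<And>x y. x \<in> A \<Longrightarrow> \<bar>f x y\<bar> \<le> 1) \<Longrightarrow>
       ?E (Pi_pmf A d P) (\<lambda>g. (?S A g) ^ 4) \<le> 3 * (real (card A))\<^sup>2"
    by auto
qed

text \<open>The centred count is a sum of n independent centred variables bounded by 1, so the
  preceding moments apply. The fourth moment later controls both the fluctuation of squared
  deviations and the Lyapunov-type sum of fourth powers.\<close>

lemma binomial_pmf_moments:
  assumes "0 < p" "p < 1"
  shows binomial_variance: "measure_pmf.expectation (binomial_pmf n p) (\<lambda>k. (real k - n * p)\<^sup>2) = n * p * (1 - p)"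
    and binomial_fourth_moment: "measure_pmf.expectation (binomial_pmf n p) (\<lambda>k. (real k - n * p) ^ 4) \<le> 3 * (real n)\<^sup>2"
    and binomial_mean: "measure_pmf.expectation (binomial_pmf n p) (\<lambda>k. real k - n * p) = 0"
proof -
  let ?Q = "Pi_pmf {..<n} False (\<lambda>_. bernoulli_pmf p)"
  let ?f = "\<lambda>(i::nat) b. of_bool b - p :: real"
  have bin: "binomial_pmf n p = map_pmf (\<lambda>f. card {x\<in>{..<n}. f x}) ?Q"
    using assms by (intro binomial_pmf_altdef') auto
  have eq: "real (card {x. x < n \<and> g x}) - n * p = (\<Sum>i<n. ?f i (g i))" for g
    by (simp add: sum_subtractf Int_def)
  have fin: "finite (set_pmf (bernoulli_pmf p))" by simp
  have mean: "measure_pmf.expectation (bernoulli_pmf p) (?f i) = 0" for i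
    using assms by (simp add: algebra_simps)
  have var: "measure_pmf.expectation (bernoulli_pmf p) (\<lambda>y. (?f i y)\<^sup>2) = p * (1 - p)" for i
    using assms by (simp add: algebra_simps power2_eq_square)
  have bd: "\<bar>?f i y\<bar> \<le> 1" for i y using assms by (cases y) auto
  show "measure_pmf.expectation (binomial_pmf n p) (\<lambda>k. real k - n * p) = 0"
    unfolding bin using expectation_sum_centered[of "{..<n}" "\<lambda>_. bernoulli_pmf p" ?f False] mean
    by (simp add: eq)
  show "measure_pmf.expectation (binomial_pmf n p) (\<lambda>k. (real k - n * p)\<^sup>2) = n * p * (1 - p)"
    unfolding bin using variance_sum_centered[of "{..<n}" "\<lambda>_. bernoulli_pmf p" ?f False] mean var
    by (simp add: eq)
  show "measure_pmf.expectation (binomial_pmf n p) (\<lambda>k. (real k - n * p) ^ 4) \<le> 3 * (real n)\<^sup>2"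
    unfolding bin using fourth_moment_sum_centered[of "{..<n}" "\<lambda>_. bernoulli_pmf p" ?f False] mean bd
    by (simp add: eq)
qed

section \<open>A central limit theorem for weighted Bernoulli sums\<close>

lemma continuous_std_normal_cdf: "isCont std_normal_cdf x"
proof -
  interpret real_distribution std_normal_distribution by (rule real_dist_normal_dist)
  have "emeasure std_normal_distribution {x} = (\<integral>\<^sup>+y. ennreal (std_normal_density y) * indicator {x} y \<partial>lborel)"
    by (subst emeasure_density) auto
  also have "\<dots> = 0"
    by (subst nn_integral_0_iff_AE) (auto intro!: AE_I[of _ _ "{x}"] simp: indicator_def)
  finally have "measure std_normal_distribution {x} = 0"
    by (simp add: measure_def)
  then show ?thesis unfolding std_normal_cdf_def by (simp add: isCont_cdf)
qed

lemma std_normal_cdf_bounds: "0 \<le> std_normal_cdf x" "std_normal_cdf x \<le> 1"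
proof -
  interpret real_distribution std_normal_distribution by (rule real_dist_normal_dist)
  show "0 \<le> std_normal_cdf x" "std_normal_cdf x \<le> 1"
    unfolding std_normal_cdf_def by (auto intro: cdf_nonneg cdf_bounded_prob)
qed

section \<open>Characteristic functions of weighted Bernoulli sums\<close>

lemma exp_minus_approx:
  fixes x :: real
  assumes "x \<ge> 0"
  shows "\<bar>exp (- x) - (1 - x)\<bar> \<le> x\<^sup>2 / 2"
proof -
  have "exp (- x) \<le> 1 - x + x\<^sup>2 / 2"
  proof -
    let ?f = "\<lambda>x::real. 1 - x + x\<^sup>2 / 2 - exp (- x)"
    have "?f 0 \<le> ?f x"
    proof (rule DERIV_nonneg_imp_nondecreasing[OF assms])
      fix y :: real assume "0 \<le> y" "y \<le> x"
      show "\<exists>d. (?f has_real_derivative d) (at y) \<and> 0 \<le> d"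
        using exp_ge_add_one_self[of "- y"]
        by (intro exI[of _ "-1 + y + exp (- y)"] conjI) (auto intro!: derivative_eq_intros)
    qed
    then show ?thesis by simp
  qed
  with exp_ge_add_one_self[of "- x"] show ?thesis by auto
qed

text \<open>Both quantities are products of complex numbers of modulus at most 1, so their distance
  is at most the sum of the distances of the factors. With v_j = p (1 - p) (w j)^2, each pair of
  factors is compared through 1 - t^2 v_j / 2: the characteristic function misses it by a
  third-moment term, the exponential by a fourth-power term.\<close>

lemma char_weighted_bernoulli_sum:
  fixes p t :: real and w :: "nat \<Rightarrow> real" and m :: nat
  assumes p: "0 < p" "p < 1"
  defines "Q \<equiv> Pi_pmf {..<m} False (\<lambda>_. bernoulli_pmf p)"
  shows "cmod (char (distr Q borel (\<lambda>X. \<Sum>j<m. w j * (of_bool (X j) - p))) t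
           - complex_of_real (exp (- (t\<^sup>2 * (p * (1 - p) * (\<Sum>j<m. (w j)\<^sup>2)) / 2))))
     \<le> \<bar>t\<bar> ^ 3 * (\<Sum>j<m. \<bar>w j\<bar> ^ 3) + t ^ 4 * (\<Sum>j<m. (w j) ^ 4)"
proof -
  let ?Y = "\<lambda>j X. w j * (of_bool (X j) - p)"
  let ?v = "\<lambda>j. p * (1 - p) * (w j)\<^sup>2"
  have finQ: "finite (set_pmf Q)"
    unfolding Q_def by auto
  have int: "integrable Q f" for f :: "_ \<Rightarrow> real"
    using finQ by (rule integrable_measure_pmf_finite)
  have comp: "measure_pmf.expectation Q (\<lambda>X. g (X j)) = measure_pmf.expectation (bernoulli_pmf p) g"
    if "j < m" for j and g :: "bool \<Rightarrow> real"
  proof -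
    have "bernoulli_pmf p = map_pmf (\<lambda>X. X j) Q"
      unfolding Q_def using that by (subst Pi_pmf_component) auto
    then show ?thesis by simp
  qed
  have indep: "prob_space.indep_vars Q (\<lambda>_. borel) ?Y {..<m}"
    unfolding Q_def
    by (rule prob_space.indep_vars_compose2[OF measure_pmf.prob_space_axioms indep_vars_Pi_pmf]) auto
  have char: "char (distr Q borel (\<lambda>X. \<Sum>j<m. ?Y j X)) t = (\<Prod>j<m. char (distr Q borel (?Y j)) t)"
    by (rule prob_space.char_distr_sum[OF measure_pmf.prob_space_axioms indep])
  have 1: "cmod (char (distr Q borel (?Y j)) t - (1 - t\<^sup>2 * ?v j / 2)) \<le> \<bar>t\<bar> ^ 3 * \<bar>w j\<bar> ^ 3 / 6"
    if j: "j < m" for j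
  proof -
    have m0: "measure_pmf.expectation Q (?Y j) = 0"
      using comp[OF j, of "\<lambda>b. w j * (of_bool b - p)"] p by (simp add: algebra_simps)
    have m2: "measure_pmf.variance Q (?Y j) = ?v j"
      using comp[OF j, of "\<lambda>b. (w j * (of_bool b - p))\<^sup>2"] p unfolding m0
      by (simp add: algebra_simps power2_eq_square)
    have "cmod (char (distr Q borel (?Y j)) t - (1 - t\<^sup>2 * ?v j / 2)) \<le>
        t\<^sup>2 / 6 * measure_pmf.expectation Q (\<lambda>X. min (6 * (?Y j X)\<^sup>2) (\<bar>t\<bar> * \<bar>?Y j X\<bar> ^ 3))"
      using prob_space.char_approx3'[OF measure_pmf.prob_space_axioms, where X = "?Y j" and t = t and ?\<sigma>2.0 = "?v j"] m0 m2 int by simp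
    also have "\<dots> \<le> t\<^sup>2 / 6 * measure_pmf.expectation Q (\<lambda>X. \<bar>t\<bar> * \<bar>w j\<bar> ^ 3)"
    proof (intro mult_left_mono integral_mono int)
      fix X :: "nat \<Rightarrow> bool"
      have "\<bar>of_bool (X j) - p\<bar> ^ 3 \<le> 1" using p by (intro power_le_one) auto
      then have "\<bar>?Y j X\<bar> ^ 3 \<le> \<bar>w j\<bar> ^ 3"
        by (simp add: abs_mult power_mult_distrib mult_left_le)
      then show "min (6 * (?Y j X)\<^sup>2) (\<bar>t\<bar> * \<bar>?Y j X\<bar> ^ 3) \<le> \<bar>t\<bar> * \<bar>w j\<bar> ^ 3"
        by (intro min.coboundedI2 mult_left_mono) auto
    qed auto
    also have "\<dots> = \<bar>t\<bar> ^ 3 * \<bar>w j\<bar> ^ 3 / 6"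
    proof -
      have "t\<^sup>2 * \<bar>t\<bar> = \<bar>t\<bar> ^ 3" by (simp add: power3_eq_cube power2_eq_square flip: abs_mult)
      then show ?thesis by (simp add: measure_pmf.prob_space mult.assoc[symmetric])
    qed
    finally show ?thesis .
  qed
  have 2: "cmod ((1 - t\<^sup>2 * ?v j / 2) - exp (- (t\<^sup>2 * ?v j / 2))) \<le> t ^ 4 * (w j) ^ 4 / 8" for j
  proof -
    have "cmod (complex_of_real (1 - t\<^sup>2 * ?v j / 2) - complex_of_real (exp (- (t\<^sup>2 * ?v j / 2))))
       = \<bar>exp (- (t\<^sup>2 * ?v j / 2)) - (1 - t\<^sup>2 * ?v j / 2)\<bar>"
      by (metis abs_minus_commute norm_of_real of_real_diff)
    also have "\<dots> \<le> (t\<^sup>2 * ?v j / 2)\<^sup>2 / 2"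
      using p by (intro exp_minus_approx) auto
    also have "\<dots> = (p * (1 - p))\<^sup>2 * (t ^ 4 * (w j) ^ 4) / 8"
      by (simp add: power_mult_distrib power_divide)
    also have "\<dots> \<le> 1 * (t ^ 4 * (w j) ^ 4) / 8"
      using p by (intro divide_right_mono mult_right_mono power_le_one) (auto intro: mult_le_one)
    finally show ?thesis by simp
  qed
  have "complex_of_real (exp (- (t\<^sup>2 * (p * (1 - p) * (\<Sum>j<m. (w j)\<^sup>2)) / 2))) =
      (\<Prod>j<m. complex_of_real (exp (- (t\<^sup>2 * ?v j / 2))))"
    by (simp add: sum_distrib_left sum_divide_distrib sum_negf flip: exp_sum of_real_prod)
  then have "cmod (char (distr Q borel (\<lambda>X. \<Sum>j<m. ?Y j X)) t
           - complex_of_real (exp (- (t\<^sup>2 * (p * (1 - p) * (\<Sum>j<m. (w j)\<^sup>2)) / 2)))) =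
      cmod ((\<Prod>j<m. char (distr Q borel (?Y j)) t) - (\<Prod>j<m. complex_of_real (exp (- (t\<^sup>2 * ?v j / 2)))))"
    by (simp only: char)
  also have "\<dots> \<le> (\<Sum>j<m. cmod (char (distr Q borel (?Y j)) t - complex_of_real (exp (- (t\<^sup>2 * ?v j / 2)))))"
  proof (rule norm_prod_diff)
    fix j
    interpret Y: real_distribution "distr Q borel (?Y j)"
      by (rule prob_space.real_distribution_distr[OF measure_pmf.prob_space_axioms]) simp
    show "cmod (char (distr Q borel (?Y j)) t) \<le> 1" by (rule Y.cmod_char_le_1)
    show "cmod (complex_of_real (exp (- (t\<^sup>2 * ?v j / 2)))) \<le> 1" using p by simp
  qed
  also have "\<dots> \<le> (\<Sum>j<m. \<bar>t\<bar> ^ 3 * \<bar>w j\<bar> ^ 3 + t ^ 4 * (w j) ^ 4)"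
  proof (rule sum_mono)
    fix j assume "j \<in> {..<m}"
    then have "cmod (char (distr Q borel (?Y j)) t - complex_of_real (exp (- (t\<^sup>2 * ?v j / 2))))
        \<le> \<bar>t\<bar> ^ 3 * \<bar>w j\<bar> ^ 3 / 6 + t ^ 4 * (w j) ^ 4 / 8"
      using norm_triangle_mono[OF 1[of j] 2[of j]] by simp
    also have "\<dots> \<le> \<bar>t\<bar> ^ 3 * \<bar>w j\<bar> ^ 3 + t ^ 4 * (w j) ^ 4"
      by (intro add_mono) auto
    finally show "cmod (char (distr Q borel (?Y j)) t - complex_of_real (exp (- (t\<^sup>2 * ?v j / 2))))
        \<le> \<bar>t\<bar> ^ 3 * \<bar>w j\<bar> ^ 3 + t ^ 4 * (w j) ^ 4" .
  qed
  finally show ?thesis by (simp add: sum.distrib sum_distrib_left)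
qed

text \<open>The \<open>\<delta>\<close> is uniform in the weights, because the lemma is applied with random weights.\<close>

lemma weighted_bernoulli_CLT:
  fixes p x \<epsilon> :: real
  assumes p: "0 < p" "p < 1" and "\<epsilon> > 0"
  shows "\<exists>\<delta>>0. \<forall>(m::nat) w. \<bar>p * (1 - p) * (\<Sum>j<m. (w j)\<^sup>2) - 1\<bar> < \<delta> \<longrightarrow> (\<Sum>j<m. (w j) ^ 4) < \<delta> \<longrightarrow>
     \<bar>measure_pmf.prob (Pi_pmf {..<m} False (\<lambda>_. bernoulli_pmf p))
        {X. (\<Sum>j<m. w j * (of_bool (X j) - p)) \<le> x} - std_normal_cdf x\<bar> < \<epsilon>"
    (is "\<exists>\<delta>>0. \<forall>m w. ?good \<delta> m w \<longrightarrow> ?good4 \<delta> m w \<longrightarrow> ?close m w")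
\<comment> \<open>If no \<open>\<delta>\<close> works, the choices 1 / (n + 1) yield a sequence of
  sizes and weights that violate the bound at \<open>x\<close> although both conditions hold ever
  more tightly; Levy's continuity theorem refutes this.\<close>
proof (rule ccontr)
  assume neg: "\<not> ?thesis"
  have "\<forall>n. \<exists>m w. ?good (1 / real (Suc n)) m w \<and> ?good4 (1 / real (Suc n)) m w \<and> \<not> ?close m w"
  proof
    fix n
    have "1 / real (Suc n) > 0" by simp
    with neg show "\<exists>m w. ?good (1 / real (Suc n)) m w \<and> ?good4 (1 / real (Suc n)) m w \<and> \<not> ?close m w" by blast
  qed
  from choice[OF this] obtain m where "\<forall>n. \<exists>w. ?good (1 / real (Suc n)) (m n) w \<and> ?good4 (1 / real (Suc n)) (m n) w \<and> \<not> ?close (m n) w"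
    by blast
  from choice[OF this] obtain w where good: "\<And>n. ?good (1 / real (Suc n)) (m n) (w n)"
      and good4: "\<And>n. ?good4 (1 / real (Suc n)) (m n) (w n)" and far: "\<And>n. \<not> ?close (m n) (w n)"
    by blast
  define S2 where "S2 = (\<lambda>n. \<Sum>j<m n. (w n j)\<^sup>2)"
  define S3 where "S3 = (\<lambda>n. \<Sum>j<m n. \<bar>w n j\<bar> ^ 3)"
  define S4 where "S4 = (\<lambda>n. \<Sum>j<m n. (w n j) ^ 4)"
  define D where "D = (\<lambda>n. distr (Pi_pmf {..<m n} False (\<lambda>_. bernoulli_pmf p)) borel
      (\<lambda>X. \<Sum>j<m n. w n j * (of_bool (X j) - p)))"
  have inv: "(\<lambda>n. 1 / real (Suc n)) \<longlonglongrightarrow> 0"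
    using LIMSEQ_inverse_real_of_nat by (simp add: inverse_eq_divide)
  have V: "(\<lambda>n. p * (1 - p) * S2 n) \<longlonglongrightarrow> 1"
  proof -
    have "(\<lambda>n. p * (1 - p) * S2 n - 1) \<longlonglongrightarrow> 0"
      by (rule Lim_null_comparison[OF always_eventually inv]) (use good less_imp_le in \<open>unfold S2_def real_norm_def, blast\<close>)
    then show ?thesis by (simp add: LIM_zero_iff)
  qed
  then have "(\<lambda>n. p * (1 - p) * S2 n / (p * (1 - p))) \<longlonglongrightarrow> 1 / (p * (1 - p))"
    using p by (intro tendsto_intros) auto
  then have S2: "S2 \<longlonglongrightarrow> 1 / (p * (1 - p))" using p by simp
  have S4: "S4 \<longlonglongrightarrow> 0"
  proof (rule tendsto_sandwich[OF always_eventually always_eventually tendsto_const inv])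
    show "\<forall>n. 0 \<le> S4 n" unfolding S4_def by (simp add: sum_nonneg)
    show "\<forall>n. S4 n \<le> 1 / real (Suc n)" unfolding S4_def using good4 less_imp_le by blast
  qed
  have S3: "S3 \<longlonglongrightarrow> 0"
  proof -
    \<comment> \<open>Cauchy-Schwarz for |w|^3 = |w| * w^2. This is why conditions on the second and
      fourth powers of the weights suffice, although the error bound contains third powers.\<close>
    have "(S3 n)\<^sup>2 \<le> S2 n * S4 n" for n
    proof -
      have 3: "\<bar>w n j\<bar> * (w n j)\<^sup>2 = \<bar>w n j\<bar> ^ 3" for j
        using power_Suc[of "\<bar>w n j\<bar>" 2] by simp
      have 4: "((w n j)\<^sup>2)\<^sup>2 = w n j ^ 4" for j
        by (simp flip: power_mult)
      show ?thesis
        using Cauchy_Schwarz_ineq_sum[of "\<lambda>j. \<bar>w n j\<bar>" "\<lambda>j. (w n j)\<^sup>2" "{..<m n}"]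
        unfolding S2_def S3_def S4_def 3 4 power2_abs .
    qed
    moreover have "(\<lambda>n. S2 n * S4 n) \<longlonglongrightarrow> 0" using tendsto_mult[OF S2 S4] by simp
    ultimately have "(\<lambda>n. (S3 n)\<^sup>2) \<longlonglongrightarrow> 0"
      by (intro tendsto_sandwich[of "\<lambda>_. 0" "\<lambda>n. (S3 n)\<^sup>2" _ "\<lambda>n. S2 n * S4 n"])
        simp_all
    from tendsto_real_sqrt[OF this] show ?thesis by (simp add: tendsto_rabs_zero_iff)
  qed
  have "weak_conv_m D std_normal_distribution"
  proof (rule levy_continuity)
    show "real_distribution (D n)" for n
      unfolding D_def by (rule prob_space.real_distribution_distr[OF measure_pmf.prob_space_axioms]) simp
    show "real_distribution std_normal_distribution" by (rule real_dist_normal_dist)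
    fix t :: real
    have "(\<lambda>n. char (D n) t - complex_of_real (exp (- (t\<^sup>2 * (p * (1 - p) * S2 n) / 2)))) \<longlonglongrightarrow> 0"
    proof (rule Lim_null_comparison[OF always_eventually])
      show "\<forall>n. norm (char (D n) t - complex_of_real (exp (- (t\<^sup>2 * (p * (1 - p) * S2 n) / 2))))
          \<le> \<bar>t\<bar> ^ 3 * S3 n + t ^ 4 * S4 n"
        unfolding D_def S2_def S3_def S4_def using char_weighted_bernoulli_sum[OF p] by blast
      show "(\<lambda>n. \<bar>t\<bar> ^ 3 * S3 n + t ^ 4 * S4 n) \<longlonglongrightarrow> 0"
        using S3 S4 by (auto intro!: tendsto_eq_intros)
    qed
    moreover have "(\<lambda>n. complex_of_real (exp (- (t\<^sup>2 * (p * (1 - p) * S2 n) / 2)))) \<longlonglongrightarrow>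
        complex_of_real (exp (- (t\<^sup>2 * 1 / 2)))"
      by (intro tendsto_intros V) auto
    ultimately have "(\<lambda>n. char (D n) t) \<longlonglongrightarrow> complex_of_real (exp (- (t\<^sup>2 * 1 / 2)))"
      by (rule Lim_transform[rotated])
    then show "(\<lambda>n. char (D n) t) \<longlonglongrightarrow> char std_normal_distribution t"
      by (simp add: char_std_normal_distribution)
  qed
  \<comment> \<open>Weak convergence yields convergence of distribution functions at continuity
    points of the limit, and \<Phi> is continuous everywhere.\<close>
  then have "(\<lambda>n. cdf (D n) x) \<longlonglongrightarrow> std_normal_cdf x"
    using continuous_std_normal_cdf[of x]
    unfolding weak_conv_m_def weak_conv_def std_normal_cdf_def by auto
  from tendstoD[OF this \<open>\<epsilon> > 0\<close>]
  obtain n where "dist (cdf (D n) x) (std_normal_cdf x) < \<epsilon>"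
    using eventually_happens trivial_limit_sequentially by blast
  moreover have "cdf (D n) x = measure_pmf.prob (Pi_pmf {..<m n} False (\<lambda>_. bernoulli_pmf p))
        {X. (\<Sum>j<m n. w n j * (of_bool (X j) - p)) \<le> x}"
    unfolding cdf_def D_def by (subst measure_distr) (auto intro!: arg_cong[of _ _ "measure_pmf.prob _"])
  ultimately show False using far[of n] by (simp add: dist_real_def)
qed

section \<open>Typical column counts\<close>

text \<open>Normalised to limit variance 1: \<open>C j\<close> has variance about m p (1 - p), so
  the squared weights sum to about 1 / (p (1 - p)), and each centred row entry has variance p (1 -
  p). The sign is chosen so that a groupie has a small score.\<close>

definition column_weight :: "real \<Rightarrow> nat \<Rightarrow> (nat \<Rightarrow> nat) \<Rightarrow> nat \<Rightarrow> real" where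
  "column_weight p m C j = ((\<Sum>i<m. real (C i)) / m - real (C j)) / (m * (p * (1 - p)))"

text \<open>The last two conditions are those of \<open>weighted_bernoulli_CLT\<close>; the first
  pins down the mean column density, on which the threshold depends.\<close>

definition typical_columns :: "real \<Rightarrow> nat \<Rightarrow> real \<Rightarrow> (nat \<Rightarrow> nat) set" where
  "typical_columns p m \<delta> = {C.
     \<bar>(\<Sum>j<m. real (C j)) / m / m - p\<bar> < \<delta> \<and>
     \<bar>p * (1 - p) * (\<Sum>j<m. (column_weight p m C j)\<^sup>2) - 1\<bar> < \<delta> \<and>
     (\<Sum>j<m. (column_weight p m C j) ^ 4) < \<delta>}"

text \<open>The weights are centred at the empirical mean of \<open>C\<close>, whereas binomial
  moments are centred at K p. The two centres differ by \<open>e\<close>, the mean of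
  \<open>D\<close>, which \<open>D1\<close> keeps small; \<open>D2\<close> and \<open>D4\<close>
  then carry over to the recentred deviations.\<close>

lemma typical_columnsI:
  fixes p \<delta> b \<eta> :: real and m K :: nat and C :: "nat \<Rightarrow> nat"
  assumes p: "0 < p" "p < 1" and "\<delta> > 0" and m: "m > 0" "\<bar>real K - real m\<bar> \<le> b" "4 * b / m < \<delta>"
  defines "D \<equiv> \<lambda>j. real (C j) - K * p"
  assumes \<eta>: "0 < \<eta>" "\<eta> \<le> 1" "\<eta> \<le> \<delta> * (p * (1 - p)) ^ 4 / 32"
    and D1: "(\<Sum>j<m. D j)\<^sup>2 < \<eta>\<^sup>2 * real m ^ 3"
    and D2: "\<bar>(\<Sum>j<m. (D j)\<^sup>2) - m * (K * p * (1 - p))\<bar> < \<eta> * (real m)\<^sup>2"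
    and D4: "(\<Sum>j<m. (D j) ^ 4) < \<eta> * real m ^ 4"
  shows "C \<in> typical_columns p m \<delta>"
proof -
  define r where "r = p * (1 - p)"
  define S1 where "S1 = (\<Sum>j<m. D j)"
  define e where "e = S1 / m"
  have r: "0 < r" "r \<le> 1" unfolding r_def using p by (auto intro: mult_le_one)
  have m1: "real m \<ge> 1" using m by simp
  \<comment> \<open>The divisor 32 is dictated by the fourth powers, whose sum is later bounded by
    16 \<eta> / r^4 \<le> \<delta> / 2. As r \<le> 1, the milder quotients by r and by 1 are covered
    too.\<close>
  have \<eta>r4: "\<eta> / r ^ 4 \<le> \<delta> / 32" using \<eta> r unfolding r_def[symmetric] by (simp add: field_simps)
  have "r ^ 4 \<le> r ^ 1" using r by (intro power_decreasing) auto
  then have "\<eta> / r \<le> \<eta> / r ^ 4" using r \<eta> by (intro divide_left_mono) auto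
  with \<eta>r4 have \<eta>r: "\<eta> / r \<le> \<delta> / 32" by linarith
  have "\<eta> \<le> \<eta> / r" using r \<eta> by (simp add: field_simps)
  with \<eta>r have \<eta>1: "\<eta> \<le> \<delta> / 32" by linarith
  have "\<eta>\<^sup>2 / r \<le> \<eta> / r" using \<eta> r by (intro divide_right_mono) (auto simp: power2_eq_square mult_left_le)
  with \<eta>r have \<eta>2: "\<eta>\<^sup>2 / r \<le> \<delta> / 32" by linarith
  have e2: "e\<^sup>2 < \<eta>\<^sup>2 * m"
    using D1 m unfolding e_def S1_def[symmetric]
    by (simp add: power_divide divide_less_eq power2_eq_square power3_eq_cube mult.assoc)
  also have "\<dots> \<le> \<eta>\<^sup>2 * (real m)\<^sup>2"
    using m1 by (intro mult_left_mono) (auto simp: power2_eq_square)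
  finally have "\<bar>e\<bar> < \<eta> * m" using \<eta> m by (intro power2_less_imp_less[of "\<bar>e\<bar>"]) (auto simp: power_mult_distrib)
  then have em: "\<bar>e / m\<bar> < \<eta>" using m by (simp add: divide_less_eq)
  have sumC: "(\<Sum>j<m. real (C j)) / m = e + K * p"
    using m unfolding e_def S1_def D_def by (simp add: sum_subtractf field_simps)
  have w: "column_weight p m C j = (e - D j) / (m * r)" for j
    unfolding column_weight_def sumC by (simp add: D_def r_def)
  have bm: "b / m < \<delta> / 4" using m by (simp add: field_simps)
  have Km: "\<bar>real K / m - 1\<bar> \<le> b / m"
  proof -
    have "real K / m - 1 = (real K - m) / m" using m by (simp add: field_simps)
    then show ?thesis using m by (simp add: divide_right_mono)
  qed
  have 1: "\<bar>(\<Sum>j<m. real (C j)) / m / m - p\<bar> < \<delta>"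
  proof -
    have "(\<Sum>j<m. real (C j)) / m / m - p = e / m + p * (real K / m - 1)"
      unfolding sumC using m by (simp add: field_simps)
    also have "\<bar>\<dots>\<bar> \<le> \<bar>e / m\<bar> + \<bar>real K / m - 1\<bar>"
      using p by (intro order_trans[OF abs_triangle_ineq] add_left_mono)
        (simp add: abs_mult mult_left_le_one_le)
    finally show ?thesis using em Km bm \<eta>1 \<open>\<delta> > 0\<close> by linarith
  qed
  have 2: "\<bar>p * (1 - p) * (\<Sum>j<m. (column_weight p m C j)\<^sup>2) - 1\<bar> < \<delta>"
  proof -
    have "(\<Sum>j<m. (e - D j)\<^sup>2) = m * e\<^sup>2 - 2 * e * S1 + (\<Sum>j<m. (D j)\<^sup>2)"
      by (simp add: power2_diff sum.distrib sum_subtractf S1_def sum_distrib_left)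
    also have "S1 = m * e" using m by (simp add: e_def)
    finally have sq: "(\<Sum>j<m. (e - D j)\<^sup>2) = (\<Sum>j<m. (D j)\<^sup>2) - m * e\<^sup>2"
      by (simp add: power2_eq_square)
    have "p * (1 - p) * (\<Sum>j<m. (column_weight p m C j)\<^sup>2) = ((\<Sum>j<m. (D j)\<^sup>2) - m * e\<^sup>2) / (m\<^sup>2 * r)"
      unfolding w r_def[symmetric] power_divide sum_divide_distrib[symmetric] sq
      using r by (simp add: power_mult_distrib power2_eq_square[of r])
    \<comment> \<open>Three sources of error: the fluctuation of the squared deviations, the gap
      between K and m, and the recentring by \<open>e\<close>.\<close>
    also have "\<dots> - 1 = ((\<Sum>j<m. (D j)\<^sup>2) - m * (K * r)) / (m\<^sup>2 * r) + (real K / m - 1) - e\<^sup>2 / m / r"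
      using m r by (simp add: power2_eq_square field_simps)
    also have "\<bar>\<dots>\<bar> \<le> \<bar>((\<Sum>j<m. (D j)\<^sup>2) - m * (K * r)) / (m\<^sup>2 * r)\<bar> + \<bar>real K / m - 1\<bar> + \<bar>e\<^sup>2 / m / r\<bar>"
      by (intro order_trans[OF abs_triangle_ineq4] add_right_mono abs_triangle_ineq)
    finally have "\<bar>p * (1 - p) * (\<Sum>j<m. (column_weight p m C j)\<^sup>2) - 1\<bar> \<le>
      \<bar>((\<Sum>j<m. (D j)\<^sup>2) - m * (K * r)) / (m\<^sup>2 * r)\<bar> + \<bar>real K / m - 1\<bar> + \<bar>e\<^sup>2 / m / r\<bar>" .
    moreover have "\<bar>((\<Sum>j<m. (D j)\<^sup>2) - m * (K * r)) / (m\<^sup>2 * r)\<bar> \<le> \<eta> / r"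
    proof -
      have "\<bar>(\<Sum>j<m. (D j)\<^sup>2) - m * (K * r)\<bar> \<le> \<eta> * (real m)\<^sup>2"
        using D2 by (simp add: r_def mult.assoc)
      then show ?thesis using m r by (simp add: abs_divide abs_mult field_simps)
    qed
    moreover have "\<bar>e\<^sup>2 / m / r\<bar> \<le> \<eta>\<^sup>2 / r"
      using e2 m r by (simp add: field_simps)
    ultimately show ?thesis using Km bm \<eta>r \<eta>2 \<open>\<delta> > 0\<close> by linarith
  qed
  have 4: "(\<Sum>j<m. (column_weight p m C j) ^ 4) < \<delta>"
  proof -
    have sq2: "(x - y)\<^sup>2 \<le> 2 * (x\<^sup>2 + y\<^sup>2)" for x y :: real
      using zero_le_power2[of "x + y"] by (simp add: power2_eq_square algebra_simps)
    have four: "(x - y) ^ 4 \<le> 8 * (x ^ 4 + y ^ 4)" for x y :: real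
    proof -
      have "(x - y) ^ 4 = ((x - y)\<^sup>2)\<^sup>2" by simp
      also have "\<dots> \<le> (2 * (x\<^sup>2 + y\<^sup>2))\<^sup>2" by (intro power_mono sq2) auto
      also have "\<dots> = 4 * (x\<^sup>2 - - (y\<^sup>2))\<^sup>2" by algebra
      also have "\<dots> \<le> 4 * (2 * ((x\<^sup>2)\<^sup>2 + (- (y\<^sup>2))\<^sup>2))" by (intro mult_left_mono sq2) auto
      finally show ?thesis by simp
    qed
    have "e ^ 4 = (e\<^sup>2)\<^sup>2" by simp
    also have "\<dots> \<le> (\<eta>\<^sup>2 * m)\<^sup>2" using e2 by (intro power_mono) auto
    also have "\<dots> = \<eta> ^ 4 * real m ^ 2" by (simp add: power_mult_distrib)
    also have "\<dots> \<le> \<eta> * real m ^ 3"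
      using \<eta> m1 power_decreasing[of 1 4 \<eta>] by (intro mult_mono power_increasing) auto
    finally have "m * e ^ 4 \<le> m * (\<eta> * real m ^ 3)" by (intro mult_left_mono) auto
    also have "\<dots> = \<eta> * real m ^ 4" by (simp add: power_Suc[symmetric] numeral_eq_Suc)
    finally have me4: "m * e ^ 4 \<le> \<eta> * real m ^ 4" .
    have "(\<Sum>j<m. (e - D j) ^ 4) \<le> (\<Sum>j<m. 8 * (e ^ 4 + D j ^ 4))"
      by (intro sum_mono four)
    also have "\<dots> = 8 * (m * e ^ 4 + (\<Sum>j<m. D j ^ 4))"
      by (simp add: sum.distrib sum_distrib_left[symmetric])
    also have "\<dots> \<le> 16 * (\<eta> * real m ^ 4)" using me4 D4 by simp
    finally have "(\<Sum>j<m. (e - D j) ^ 4) / (m * r) ^ 4 \<le> 16 * (\<eta> * real m ^ 4) / (m * r) ^ 4"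
      by (intro divide_right_mono) auto
    also have "\<dots> = 16 * (\<eta> / r ^ 4)" using m r by (simp add: power_mult_distrib)
    also have "\<dots> < \<delta>" using \<eta>r4 \<open>\<delta> > 0\<close> by linarith
    finally show ?thesis unfolding w power_divide sum_divide_distrib[symmetric] .
  qed
  show ?thesis using 1 2 4 by (simp add: typical_columns_def)
qed

text \<open>Markov's inequality for the squared sum, the squared fluctuation of the squares and the
  sum of fourth powers. Their expectations are of order at most m^2, m^3 and m^3 against bounds of
  order m^3, m^4 and m^4, so each failure has probability O(1/m), uniformly in the admissible
  K.\<close>

lemma prob_atypical_columns:
  fixes p \<delta> b :: real
  assumes p: "0 < p" "p < 1" and "\<delta> > 0"
  shows "\<exists>M. \<forall>m\<ge>M. \<forall>K. \<bar>real K - real m\<bar> \<le> b \<longrightarrow>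
    measure_pmf.prob (Pi_pmf {..<m} 0 (\<lambda>_. binomial_pmf K p)) (- typical_columns p m \<delta>) \<le> \<delta>"
proof -
  define \<eta> where "\<eta> = min 1 (\<delta> * (p * (1 - p)) ^ 4 / 32)"
  have \<eta>: "0 < \<eta>" "\<eta> \<le> 1" "\<eta> \<le> \<delta> * (p * (1 - p)) ^ 4 / 32"
    unfolding \<eta>_def using p \<open>\<delta> > 0\<close> by auto
  \<comment> \<open>The terms ensure K \<le> 2 m, \<open>4 * b / m < \<delta>\<close> and a total
    failure probability of at most \<open>\<delta>\<close>. Here 26 = 2 + 12 + 12 adds up the three
    Markov bounds, and 12 comes from 3 K^2 \<le> 12 m^2.\<close>
  obtain M :: nat where M: "real M > 1 + \<bar>b\<bar> + 4 * \<bar>b\<bar> / \<delta> + 26 / (\<eta>\<^sup>2 * \<delta>)"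
    using reals_Archimedean2 by blast
  have "measure_pmf.prob (Pi_pmf {..<m} 0 (\<lambda>_. binomial_pmf K p)) (- typical_columns p m \<delta>) \<le> \<delta>"
    if "m \<ge> M" and Km: "\<bar>real K - real m\<bar> \<le> b" for m K
  proof -
    let ?B = "binomial_pmf K p"
    let ?P = "Pi_pmf {..<m} 0 (\<lambda>_. ?B)"
    let ?E = "measure_pmf.expectation"
    let ?d = "\<lambda>c. real c - K * p"
    let ?v = "K * p * (1 - p)"
    have "real m \<ge> real M" using that by simp
    moreover have "4 * \<bar>b\<bar> / \<delta> \<ge> 0" "26 / (\<eta>\<^sup>2 * \<delta>) \<ge> 0" using \<open>\<delta> > 0\<close> by auto
    ultimately have m: "real m > 1" "real m > \<bar>b\<bar>" "real m > 4 * \<bar>b\<bar> / \<delta>" "real m > 26 / (\<eta>\<^sup>2 * \<delta>)"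
      using M by linarith+
    have bm: "4 * b / m < \<delta>"
    proof -
      have "4 * \<bar>b\<bar> < m * \<delta>" using m(3) \<open>\<delta> > 0\<close> by (simp add: divide_less_eq)
      then show ?thesis using m by (simp add: divide_less_eq mult.commute)
    qed
    have K: "real K \<le> 2 * m" using Km m by linarith
    have K2: "(real K)\<^sup>2 \<le> 4 * (real m)\<^sup>2" using power_mono[OF K, of 2] by simp
    have v: "0 \<le> ?v" "?v \<le> K" using p by (auto simp: mult_le_one mult.assoc intro!: mult_left_le)
    have finB: "finite (set_pmf ?B)" using p by simp
    have finP: "finite (set_pmf ?P)" using finB by auto
    note int = integrable_measure_pmf_finite[OF finB] integrable_measure_pmf_finite[OF finP]
    have B: "?E ?B ?d = 0" "?E ?B (\<lambda>c. (?d c)\<^sup>2) = ?v" "?E ?B (\<lambda>c. ?d c ^ 4) \<le> 3 * (real K)\<^sup>2"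
      using binomial_mean binomial_variance binomial_fourth_moment p by auto
    define B1 B2 B4 where "B1 = {C. (\<Sum>j<m. ?d (C j))\<^sup>2 \<ge> \<eta>\<^sup>2 * real m ^ 3}"
      and "B2 = {C. (\<Sum>j<m. (?d (C j))\<^sup>2 - ?v)\<^sup>2 \<ge> (\<eta> * (real m)\<^sup>2)\<^sup>2}"
      and "B4 = {C. (\<Sum>j<m. ?d (C j) ^ 4) \<ge> \<eta> * real m ^ 4}"
    have P1: "measure_pmf.prob ?P B1 \<le> 2 / (\<eta>\<^sup>2 * m)"
    proof -
      have "measure_pmf.prob ?P B1 \<le> ?E ?P (\<lambda>C. (\<Sum>j<m. ?d (C j))\<^sup>2) / (\<eta>\<^sup>2 * real m ^ 3)"
        unfolding B1_def using \<eta> m by (intro pmf_Markov finP) auto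
      also have "?E ?P (\<lambda>C. (\<Sum>j<m. ?d (C j))\<^sup>2) = m * ?v"
        using variance_sum_centered[of "{..<m}" "\<lambda>_. ?B" "\<lambda>_. ?d" 0] B finB by simp
      also have "m * ?v / (\<eta>\<^sup>2 * real m ^ 3) \<le> m * (2 * m) / (\<eta>\<^sup>2 * real m ^ 3)"
        using mult_left_mono[OF order_trans[OF v(2) K], of m] by (intro divide_right_mono) auto
      also have "\<dots> = 2 / (\<eta>\<^sup>2 * m)" using m \<eta> by (simp add: power3_eq_cube)
      finally show ?thesis .
    qed
    have P2: "measure_pmf.prob ?P B2 \<le> 12 / (\<eta>\<^sup>2 * m)"
    proof -
      have "measure_pmf.prob ?P B2 \<le> ?E ?P (\<lambda>C. (\<Sum>j<m. (?d (C j))\<^sup>2 - ?v)\<^sup>2) / (\<eta> * (real m)\<^sup>2)\<^sup>2"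
        unfolding B2_def using \<eta> m by (intro pmf_Markov finP) auto
      also have "?E ?P (\<lambda>C. (\<Sum>j<m. (?d (C j))\<^sup>2 - ?v)\<^sup>2) = m * ?E ?B (\<lambda>c. ((?d c)\<^sup>2 - ?v)\<^sup>2)"
        using variance_sum_centered[of "{..<m}" "\<lambda>_. ?B" "\<lambda>_ c. (?d c)\<^sup>2 - ?v" 0] B finB by (simp add: int)
      also have "?E ?B (\<lambda>c. ((?d c)\<^sup>2 - ?v)\<^sup>2) = ?E ?B (\<lambda>c. ?d c ^ 4) - ?v\<^sup>2"
      proof -
        have "((?d c)\<^sup>2 - ?v)\<^sup>2 = ?d c ^ 4 - 2 * ?v * (?d c)\<^sup>2 + ?v\<^sup>2" for c
          by algebra
        then show ?thesis using B by (simp add: int power2_eq_square)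
      qed
      also have "m * (?E ?B (\<lambda>c. ?d c ^ 4) - ?v\<^sup>2) / (\<eta> * (real m)\<^sup>2)\<^sup>2 \<le> m * (12 * (real m)\<^sup>2) / (\<eta> * (real m)\<^sup>2)\<^sup>2"
      proof (intro divide_right_mono mult_left_mono)
        show "?E ?B (\<lambda>c. ?d c ^ 4) - ?v\<^sup>2 \<le> 12 * (real m)\<^sup>2"
          using B(3) K2 zero_le_power2[of ?v] by linarith
      qed auto
      also have "\<dots> = 12 / (\<eta>\<^sup>2 * m)" using m \<eta> by (simp add: power2_eq_square)
      finally show ?thesis .
    qed
    have P4: "measure_pmf.prob ?P B4 \<le> 12 / (\<eta>\<^sup>2 * m)"
    proof -
      have "measure_pmf.prob ?P B4 \<le> ?E ?P (\<lambda>C. \<Sum>j<m. ?d (C j) ^ 4) / (\<eta> * real m ^ 4)"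
        unfolding B4_def using \<eta> m by (intro pmf_Markov finP) (auto intro: sum_nonneg)
      also have "?E ?P (\<lambda>C. \<Sum>j<m. ?d (C j) ^ 4) = m * ?E ?B (\<lambda>c. ?d c ^ 4)"
        using expectation_sum_Pi_pmf[of "{..<m}" "\<lambda>_. ?B" "\<lambda>c. ?d c ^ 4" 0] by (simp add: int)
      also have "m * ?E ?B (\<lambda>c. ?d c ^ 4) / (\<eta> * real m ^ 4) \<le> m * (12 * (real m)\<^sup>2) / (\<eta> * real m ^ 4)"
        using B(3) K2 \<eta> by (intro divide_right_mono mult_left_mono) auto
      also have "\<dots> = 12 / (\<eta> * m)" using m \<eta> by (simp add: power2_eq_square power4_eq_xxxx)
      also have "\<dots> \<le> 12 / (\<eta>\<^sup>2 * m)"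
        using \<eta> m by (intro divide_left_mono mult_right_mono) (auto simp: power2_eq_square mult_left_le)
      finally show ?thesis .
    qed
    have "- typical_columns p m \<delta> \<subseteq> B1 \<union> B2 \<union> B4"
    proof
      fix C assume C: "C \<in> - typical_columns p m \<delta>"
      show "C \<in> B1 \<union> B2 \<union> B4"
      proof (rule ccontr)
        assume n: "C \<notin> B1 \<union> B2 \<union> B4"
        have "(\<Sum>j<m. (?d (C j))\<^sup>2 - ?v)\<^sup>2 < (\<eta> * (real m)\<^sup>2)\<^sup>2"
          using n by (simp add: B2_def not_le)
        then have "\<bar>\<Sum>j<m. (?d (C j))\<^sup>2 - ?v\<bar> < \<eta> * (real m)\<^sup>2"
          using \<eta>(1) power2_less_imp_less[of "\<bar>\<Sum>j<m. (?d (C j))\<^sup>2 - ?v\<bar>" "\<eta> * (real m)\<^sup>2"]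
          unfolding power2_abs by (simp add: less_imp_le)
        then have "\<bar>(\<Sum>j<m. (?d (C j))\<^sup>2) - m * ?v\<bar> < \<eta> * (real m)\<^sup>2"
          by (simp add: sum_subtractf)
        moreover have "(\<Sum>j<m. ?d (C j))\<^sup>2 < \<eta>\<^sup>2 * real m ^ 3"
          using n unfolding B1_def by (simp only: Un_iff mem_Collect_eq not_le de_Morgan_disj)
        moreover have "(\<Sum>j<m. ?d (C j) ^ 4) < \<eta> * real m ^ 4"
          using n unfolding B4_def by (simp only: Un_iff mem_Collect_eq not_le de_Morgan_disj)
        ultimately have "C \<in> typical_columns p m \<delta>"
          using m by (intro typical_columnsI[OF p \<open>\<delta> > 0\<close> _ Km bm \<eta>]) auto
        with C show False by simp
      qed
    qed
    then have "measure_pmf.prob ?P (- typical_columns p m \<delta>) \<le> measure_pmf.prob ?P (B1 \<union> B2 \<union> B4)"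
      by (intro measure_pmf.finite_measure_mono) auto
    also have "\<dots> \<le> measure_pmf.prob ?P B1 + measure_pmf.prob ?P B2 + measure_pmf.prob ?P B4"
      using measure_Un_le[of "B1 \<union> B2" ?P B4]
        measure_Un_le[of B1 ?P B2] by simp
    also have "\<dots> \<le> 26 / (\<eta>\<^sup>2 * m)" using add_mono[OF add_mono[OF P1 P2] P4]
      by (simp add: add_divide_distrib[symmetric])
    also have "\<dots> \<le> \<delta>"
    proof -
      have "26 < m * (\<eta>\<^sup>2 * \<delta>)" using m(4) \<eta>(1) \<open>\<delta> > 0\<close> by (simp add: divide_less_eq)
      then show ?thesis using m(1) \<eta>(1) by (simp add: divide_le_eq mult_ac)
    qed
    finally show ?thesis .
  qed
  then show ?thesis by blast
qed

section \<open>Random bipartite graphs as random matrices\<close>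

lemma nbrs_image:
  assumes "bij f"
  shows "nbrs ((`) f ` E) (f v) = f ` nbrs E v"
proof -
  have inj: "inj ((`) f)" using assms by (simp add: bij_is_inj inj_on_image)
  have mem: "f ` e \<in> (`) f ` E \<longleftrightarrow> e \<in> E" for e
    using inj by (rule inj_image_mem_iff)
  have "{f u, f v} \<in> (`) f ` E \<longleftrightarrow> {u, v} \<in> E" for u
    using mem[of "{u, v}"] by simp
  moreover have "\<exists>u. w = f u" for w using assms by (auto simp: bij_def surj_def)
  ultimately show ?thesis
    unfolding nbrs_def by (auto simp: image_iff) metis
qed

lemma deg_image: "bij f \<Longrightarrow> deg ((`) f ` E) (f v) = deg E v"
  unfolding deg_def by (simp add: nbrs_image card_image bij_is_inj inj_on_subset[OF _ subset_UNIV])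

lemma nbr_deg_sum_image: "bij f \<Longrightarrow> nbr_deg_sum ((`) f ` E) (f v) = nbr_deg_sum E v"
  unfolding nbr_deg_sum_def
  by (simp add: nbrs_image sum.reindex bij_is_inj inj_on_subset[OF _ subset_UNIV] deg_image)

text \<open>Neighbourhoods range over the whole vertex type and not only over \<open>V\<close>, so
  the relabelling is a bijection of the type.\<close>

lemma groupie_image:
  assumes "bij f"
  shows "groupie (f ` V) ((`) f ` E) (f v) \<longleftrightarrow> groupie V E v"
proof -
  have inj: "inj f" "inj ((`) f)" using assms by (simp_all add: bij_is_inj inj_on_image)
  show ?thesis
    unfolding groupie_def deg_image[OF assms] nbr_deg_sum_image[OF assms]
    using inj by (simp add: inj_image_mem_iff card_image inj_on_subset[OF _ subset_UNIV] deg_image[OF assms])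
qed

definition swap_sides :: "nat + nat \<Rightarrow> nat + nat" where
  "swap_sides = case_sum Inr Inl"

lemma swap_sides_simps [simp]: "swap_sides (Inl i) = Inr i" "swap_sides (Inr i) = Inl i"
  by (simp_all add: swap_sides_def)

lemma swap_sides_invol [simp]: "swap_sides (swap_sides v) = v"
  by (cases v) auto

lemma bij_swap_sides: "bij swap_sides"
  by (rule bijI') (metis swap_sides_invol)+

lemma swap_sides_bip_verts: "swap_sides ` bip_verts n1 n2 = bip_verts n2 n1"
  unfolding bip_verts_def by (force simp: image_iff Plus_def)

lemma image_swap_sides_invol [simp]: "swap_sides ` swap_sides ` e = e"
  by (simp add: image_image)

lemma swap_sides_bip_pairs: "swap_sides ` e \<in> bip_pairs n1 n2 \<longleftrightarrow> e \<in> bip_pairs n2 n1"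
proof -
  have *: "swap_sides ` e \<in> bip_pairs n1 n2" if "e \<in> bip_pairs n2 n1" for e n1 n2
    using that unfolding bip_pairs_def by (force simp: insert_commute)
  from *[of e n2 n1] *[of "swap_sides ` e" n1 n2] show ?thesis by auto
qed

lemma finite_bip_pairs [simp]: "finite (bip_pairs n1 n2)"
proof -
  have "bip_pairs n1 n2 = (\<lambda>(i, j). {Inl i, Inr j}) ` ({..<n1} \<times> {..<n2})"
    unfolding bip_pairs_def by auto
  then show ?thesis by simp
qed

lemma random_bipartite_swap_sides:
  "random_bipartite n2 n1 p = map_pmf ((`) ((`) swap_sides)) (random_bipartite n1 n2 p)"
proof -
  have "bij_betw ((`) swap_sides) (bip_pairs n2 n1) (bip_pairs n1 n2)"
    by (rule bij_betwI[where g = "(`) swap_sides"]) (auto simp: swap_sides_bip_pairs)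
  then have "Pi_pmf (bip_pairs n2 n1) False (\<lambda>_. bernoulli_pmf p) =
      map_pmf (\<lambda>g. g \<circ> (`) swap_sides) (Pi_pmf (bip_pairs n1 n2) False (\<lambda>_. bernoulli_pmf p))"
    by (intro Pi_pmf_bij_betw) (auto simp: swap_sides_bip_pairs)
  moreover have "{e \<in> bip_pairs n2 n1. \<omega> (swap_sides ` e)} = (`) swap_sides ` {e \<in> bip_pairs n1 n2. \<omega> e}" for \<omega>
  proof (intro equalityI subsetI)
    fix e assume "e \<in> {e \<in> bip_pairs n2 n1. \<omega> (swap_sides ` e)}"
    then show "e \<in> (`) swap_sides ` {e \<in> bip_pairs n1 n2. \<omega> e}"
      by (intro image_eqI[of _ _ "swap_sides ` e"]) (auto simp: swap_sides_bip_pairs)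
  qed (auto simp: swap_sides_bip_pairs)
  ultimately show ?thesis
    by (simp add: random_bipartite_def pmf.map_comp o_def)
qed

section \<open>Edges as entries of a random 0-1 matrix, with left vertices as rows\<close>

definition bip_graph :: "nat \<Rightarrow> nat \<Rightarrow> (nat \<times> nat \<Rightarrow> bool) \<Rightarrow> (nat + nat) set set" where
  "bip_graph k m X = {{Inl i, Inr j} | i j. i < k \<and> j < m \<and> X (i, j)}"

definition random_matrix :: "nat \<Rightarrow> nat \<Rightarrow> real \<Rightarrow> (nat \<times> nat \<Rightarrow> bool) pmf" where
  "random_matrix k m p = Pi_pmf ({..<k} \<times> {..<m}) False (\<lambda>_. bernoulli_pmf p)"

lemma random_bipartite_eq_random_matrix:
  "random_bipartite k m p = map_pmf (bip_graph k m) (random_matrix k m p)"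
proof -
  let ?h = "\<lambda>(i, j). {Inl i, Inr j} :: (nat + nat) set"
  have "bij_betw ?h ({..<k} \<times> {..<m}) (bip_pairs k m)"
    by (auto simp: bij_betw_def inj_on_def bip_pairs_def doubleton_eq_iff image_iff)
  then have "random_matrix k m p = map_pmf (\<lambda>g. g \<circ> ?h) (Pi_pmf (bip_pairs k m) False (\<lambda>_. bernoulli_pmf p))"
    unfolding random_matrix_def
    by (intro Pi_pmf_bij_betw) (auto simp: bip_pairs_def doubleton_eq_iff)
  moreover have "bip_graph k m (\<omega> \<circ> ?h) = {e \<in> bip_pairs k m. \<omega> e}" for \<omega>
    unfolding bip_graph_def bip_pairs_def by auto
  ultimately show ?thesis
    by (simp add: random_bipartite_def pmf.map_comp o_def)
qed

lemma nbrs_bip_graph: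
  "i < k \<Longrightarrow> nbrs (bip_graph k m X) (Inl i) = Inr ` {j. j < m \<and> X (i, j)}"
  "j < m \<Longrightarrow> nbrs (bip_graph k m X) (Inr j) = Inl ` {i. i < k \<and> X (i, j)}"
  unfolding nbrs_def bip_graph_def by (auto simp: doubleton_eq_iff)

lemma deg_bip_graph:
  "i < k \<Longrightarrow> deg (bip_graph k m X) (Inl i) = card {j. j < m \<and> X (i, j)}"
  "j < m \<Longrightarrow> deg (bip_graph k m X) (Inr j) = card {i. i < k \<and> X (i, j)}"
  unfolding deg_def by (simp_all add: nbrs_bip_graph card_image)

lemma card_bip_graph: "card (bip_graph k m X) = (\<Sum>j<m. card {i. i < k \<and> X (i, j)})"
proof -
  let ?h = "\<lambda>(j, i). {Inl i, Inr j} :: (nat + nat) set"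
  have "bip_graph k m X = ?h ` (SIGMA j:{..<m}. {i. i < k \<and> X (i, j)})"
    unfolding bip_graph_def by force
  moreover have "inj_on ?h (SIGMA j:{..<m}. {i. i < k \<and> X (i, j)})"
    by (auto simp: inj_on_def doubleton_eq_iff)
  ultimately show ?thesis by (simp add: card_image)
qed

lemma groupie_bip_graph:
  assumes "v < k" and "card {j. j < m \<and> X (v, j)} \<noteq> 0"
  shows "groupie (bip_verts k m) (bip_graph k m X) (Inl v) \<longleftrightarrow>
    2 * (\<Sum>j<m. real (card {i. i < k \<and> X (i, j)})) / (real k + real m)
      \<le> (\<Sum>j<m. of_bool (X (v, j)) * real (card {i. i < k \<and> X (i, j)})) / real (card {j. j < m \<and> X (v, j)})"
proof -
  have "real (nbr_deg_sum (bip_graph k m X) (Inl v)) = (\<Sum>j | j < m \<and> X (v, j). real (card {i. i < k \<and> X (i, j)}))"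
    unfolding nbr_deg_sum_def using assms
    by (simp add: nbrs_bip_graph sum.reindex deg_bip_graph)
  also have "\<dots> = (\<Sum>j<m. of_bool (X (v, j)) * real (card {i. i < k \<and> X (i, j)}))"
    by (rule sum.mono_neutral_cong_left) auto
  finally show ?thesis
    using assms unfolding groupie_def deg_bip_graph(1)[OF assms(1)] if_not_P[OF assms(2)]
    by (simp add: card_bip_graph bip_verts_def card_Plus InlI)
qed

section \<open>The groupie inequality as a bound on a linear statistic of one row\<close>

lemma card_pair_column:
  fixes v v' :: nat
  assumes "v < k" "v' < k" "v \<noteq> v'"
  shows "real (card {i. i < k \<and> x i}) = of_bool (x v) + of_bool (x v') + real (card {i \<in> {..<k} - {v, v'}. x i})"
proof -
  define R where "R = {..<k} - {v, v'}"
  have R: "finite R" "v' \<notin> R" "v \<notin> insert v' R" "{..<k} = insert v (insert v' R)"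
    unfolding R_def using assms by auto
  have card: "real (card {i \<in> A. x i}) = (\<Sum>i\<in>A. of_bool (x i))" if "finite A" for A
    using that by (simp add: Int_def)
  have "{i. i < k \<and> x i} = {i \<in> insert v (insert v' R). x i}" unfolding R(4)[symmetric] by auto
  also have "real (card \<dots>) = of_bool (x v) + (of_bool (x v') + real (card {i \<in> R. x i}))"
    using R by (subst (1 2) card) simp_all
  finally show ?thesis by (simp add: R_def)
qed

text \<open>The arguments stand for $m/(k+m)$, the densities of the rows of \<open>v\<close> and \<open>v'\<close> and of their
  intersection, and the mean column count divided by $m$.\<close>

definition groupie_threshold :: "real \<Rightarrow> real \<Rightarrow> real \<times> real \<times> real \<times> real \<times> real \<Rightarrow> real" where
  "groupie_threshold p c = (\<lambda>(\<rho>, \<alpha>, \<beta>, \<gamma>, \<kappa>). (\<gamma> - \<alpha> * (2 * \<rho> * (\<alpha> + \<beta>) - 1 - c * \<kappa> * \<rho>)) / (p * (1 - p)))"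

text \<open>An exact equivalence. After clearing the degree \<open>a\<close> of v, the column counts
  enter only through a S / m - T, which is m p (1 - p) times the statistic, and through the mean S /
  m in a term with factor c. Everything else concerns the two rows and goes into the
  threshold.\<close>

lemma groupie_iff_threshold:
  fixes k m :: nat and X :: "nat \<times> nat \<Rightarrow> bool"
  assumes p: "0 < p" "p < 1" and v: "v < k" "v' < k" "v \<noteq> v'" and m: "m > 0"
    and c: "real k - real m = c"
  defines "A \<equiv> \<lambda>j. X (v, j)" and "B \<equiv> \<lambda>j. X (v', j)"
    and "C \<equiv> \<lambda>j. card {i \<in> {..<k} - {v, v'}. X (i, j)}"
  assumes a: "(\<Sum>j<m. of_bool (A j)) > (0::real)"
  shows "groupie (bip_verts k m) (bip_graph k m X) (Inl v) \<longleftrightarrow>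
    (\<Sum>j<m. column_weight p m C j * (of_bool (A j) - p)) \<le>
    groupie_threshold p c (m / (k + m), (\<Sum>j<m. of_bool (A j)) / m, (\<Sum>j<m. of_bool (B j)) / m,
      (\<Sum>j<m. of_bool (A j \<and> B j)) / m, (\<Sum>j<m. real (C j)) / m / m)"
proof -
  define a where "a = (\<Sum>j<m. of_bool (A j) :: real)"
  define b where "b = (\<Sum>j<m. of_bool (B j) :: real)"
  define d where "d = (\<Sum>j<m. of_bool (A j \<and> B j) :: real)"
  define S where "S = (\<Sum>j<m. real (C j))"
  define T where "T = (\<Sum>j<m. of_bool (A j) * real (C j))"
  define n where "n = real k + real m"
  define r where "r = p * (1 - p)"
  have r: "r > 0" unfolding r_def using p by simp
  have a: "a > 0" using assms(11) by (simp add: a_def)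
  have n: "n > 0" using m by (simp add: n_def)
  have card_a: "real (card {j. j < m \<and> X (v, j)}) = a"
    unfolding a_def A_def by (simp add: Int_def)
  have col: "real (card {i. i < k \<and> X (i, j)}) = of_bool (A j) + of_bool (B j) + real (C j)" for j
    unfolding A_def B_def C_def by (rule card_pair_column[OF v])
  have sum1: "(\<Sum>j<m. real (card {i. i < k \<and> X (i, j)})) = a + b + S"
    unfolding col by (simp add: sum.distrib a_def b_def S_def)
  have sum2: "(\<Sum>j<m. of_bool (X (v, j)) * real (card {i. i < k \<and> X (i, j)})) = a + d + T"
  proof -
    have "of_bool (X (v, j)) * real (card {i. i < k \<and> X (i, j)}) =
        of_bool (A j) + of_bool (A j \<and> B j) + of_bool (A j) * real (C j)" for j
      unfolding col by (simp add: A_def)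
    then show ?thesis by (simp add: sum.distrib a_def d_def T_def)
  qed
  \<comment> \<open>The weights sum to zero, so the centring of the row by p drops out.\<close>
  have W: "(\<Sum>j<m. column_weight p m C j * (of_bool (A j) - p)) = (a * S / m - T) / (m * r)"
  proof -
    have "(\<Sum>j<m. (S / m - real (C j)) * (of_bool (A j) - p)) =
      (\<Sum>j<m. S / m * of_bool (A j) - of_bool (A j) * real (C j) - p * (S / m) + p * real (C j))"
      by (intro sum.cong) (auto simp: algebra_simps)
    also have "\<dots> = S / m * a - T - p * (m * (S / m)) + p * S"
      by (simp only: sum.distrib sum_subtractf sum_distrib_left[symmetric] a_def[symmetric]
          T_def[symmetric] S_def[symmetric] sum_constant card_lessThan)
    also have "\<dots> = a * S / m - T" using m by simp
    finally show ?thesis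
      by (simp add: column_weight_def S_def[symmetric] r_def[symmetric] sum_divide_distrib[symmetric])
  qed
  have "groupie (bip_verts k m) (bip_graph k m X) (Inl v) \<longleftrightarrow> 2 * (a + b + S) / n \<le> (a + d + T) / a"
  proof -
    have "card {j. j < m \<and> X (v, j)} \<noteq> 0" using a card_a by (metis less_irrefl of_nat_0)
    from groupie_bip_graph[OF v(1) this] show ?thesis
      unfolding sum1 sum2 card_a n_def .
  qed
  also have "\<dots> \<longleftrightarrow> a * (2 * (a + b + S) / n) - a - d - T \<le> 0"
    using a by (simp add: le_divide_eq algebra_simps)
  also have "a * (2 * (a + b + S) / n) - a - d - T =
      (a * S / m - T) - (d - a * (2 * (a + b) / n - 1 - c * (S / m) / n))"
  proof -
    have nm: "n - 2 * m = c" using c by (simp add: n_def)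
    \<comment> \<open>From n - 2 m = c one gets 2 / n = 1 / m - c / (m n): the overall average
      becomes the average over columns plus a correction, the only place where the imbalance of the
      sides enters.\<close>
    have "2 * S / n = S / m - c * (S / m) / n"
      unfolding nm[symmetric] using n m by (simp add: field_simps)
    then have "a * (2 * (a + b + S) / n) = a * (2 * (a + b) / n) + a * (S / m - c * (S / m) / n)"
      by (simp add: add_divide_distrib distrib_left)
    then show ?thesis by (simp add: algebra_simps)
  qed
  also have "\<dots> \<le> 0 \<longleftrightarrow> (a * S / m - T) / (m * r) \<le> (d - a * (2 * (a + b) / n - 1 - c * (S / m) / n)) / (m * r)"
    using m r by (simp add: divide_le_cancel mult_less_0_iff)
  also have "(d - a * (2 * (a + b) / n - 1 - c * (S / m) / n)) / (m * r) =
      groupie_threshold p c (m / n, a / m, b / m, d / m, S / m / m)"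
  proof -
    have "2 * (m / n) * (a / m + b / m) = 2 * (a + b) / n" "c * (S / m / m) * (m / n) = c * (S / m) / n"
      using m n by (simp_all add: field_simps)
    moreover have "(d - a * y) / (x * z) = (d / x - a / x * y) / z" for x y z :: real
      by (simp add: diff_divide_distrib)
    ultimately show ?thesis
      unfolding groupie_threshold_def r_def[symmetric] prod.case by (simp only:)
  qed
  finally show ?thesis unfolding W n_def a_def b_def d_def S_def by simp
qed

text \<open>Columns are independent, and within a column the entries of v and v' are independent of
  each other and of the remaining k - 2 entries, whose number of successes is binomial. Hence each
  column is reduced to a triple by \<open>g\<close>, and the vector of independent triples is then
  split into its three coordinates.\<close>

lemma random_matrix_two_rows:
  fixes v v' k m :: nat
  assumes p: "0 < p" "p < 1" and v: "v < k" "v' < k" "v \<noteq> v'"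
  defines "Q \<equiv> Pi_pmf {..<m} False (\<lambda>_. bernoulli_pmf p)"
  shows "map_pmf (\<lambda>X. (\<lambda>j. card {i \<in> {..<k} - {v, v'}. X (i, j)}, \<lambda>j. X (v, j), \<lambda>j. X (v', j))) (random_matrix k m p) =
    pair_pmf (Pi_pmf {..<m} 0 (\<lambda>_. binomial_pmf (k - 2) p)) (pair_pmf Q Q)"
proof -
  define R where "R = {..<k} - {v, v'}"
  define b where "b = bernoulli_pmf p"
  define g where "g = (\<lambda>x :: nat \<Rightarrow> bool. (card {i \<in> R. x i}, x v, x v'))"
  have R: "finite R" "v' \<notin> R" "v \<notin> insert v' R" "{..<k} = insert v (insert v' R)" "card R = k - 2"
    unfolding R_def using v by (auto simp: card_Diff_subset)
  have bin: "binomial_pmf (k - 2) p = map_pmf (\<lambda>f. card {i \<in> R. f i}) (Pi_pmf R False (\<lambda>_. b))"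
    unfolding b_def using R p by (intro binomial_pmf_altdef') auto
  have "map_pmf g (Pi_pmf {..<k} False (\<lambda>_. b)) =
      do {x \<leftarrow> b; y \<leftarrow> b; f \<leftarrow> Pi_pmf R False (\<lambda>_. b); return_pmf (g (f(v' := y, v := x)))}"
    using R by (simp add: Pi_pmf_insert' map_bind_pmf bind_assoc_pmf bind_return_pmf)
  also have "\<dots> = do {x \<leftarrow> b; y \<leftarrow> b; f \<leftarrow> Pi_pmf R False (\<lambda>_. b); return_pmf (card {i \<in> R. f i}, x, y)}"
  proof -
    have "g (f(v' := y, v := x)) = (card {i \<in> R. f i}, x, y)" for f x y
    proof -
      have "{i \<in> R. (f(v' := y, v := x)) i} = {i \<in> R. f i}" using R by auto
      then show ?thesis using v by (simp add: g_def)
    qed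
    then show ?thesis by simp
  qed
  also have "\<dots> = do {x \<leftarrow> b; f \<leftarrow> Pi_pmf R False (\<lambda>_. b); y \<leftarrow> b; return_pmf (card {i \<in> R. f i}, x, y)}"
    by (subst bind_commute_pmf[of b "Pi_pmf R False (\<lambda>_. b)"]) simp
  also have "\<dots> = do {f \<leftarrow> Pi_pmf R False (\<lambda>_. b); x \<leftarrow> b; y \<leftarrow> b; return_pmf (card {i \<in> R. f i}, x, y)}"
    by (rule bind_commute_pmf)
  also have "\<dots> = pair_pmf (binomial_pmf (k - 2) p) (pair_pmf b b)"
    unfolding bin pair_pmf_def by (simp add: bind_map_pmf bind_assoc_pmf bind_return_pmf)
  finally have col: "map_pmf g (Pi_pmf {..<k} False (\<lambda>_. b)) = pair_pmf (binomial_pmf (k - 2) p) (pair_pmf b b)" .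
  have "map_pmf (\<lambda>X j. g (\<lambda>i. X (i, j))) (random_matrix k m p) =
     map_pmf (\<lambda>h. g \<circ> h) (map_pmf (\<lambda>X j i. X (i, j)) (random_matrix k m p))"
    by (simp add: pmf.map_comp o_def)
  also have "\<dots> = map_pmf (\<lambda>h. g \<circ> h) (Pi_pmf {..<m} (\<lambda>_. False) (\<lambda>_. Pi_pmf {..<k} False (\<lambda>_. b)))"
    unfolding random_matrix_def b_def by (simp add: Pi_pmf_Times)
  \<comment> \<open>The default of the mapped product has to be the value of \<open>g\<close> on the
    all-\<open>False\<close> column.\<close>
  also have "\<dots> = Pi_pmf {..<m} (0, False, False) (\<lambda>_. map_pmf g (Pi_pmf {..<k} False (\<lambda>_. b)))"
    by (rule Pi_pmf_map[symmetric]) (auto simp: g_def)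
  finally have cols: "map_pmf (\<lambda>X j. g (\<lambda>i. X (i, j))) (random_matrix k m p) =
      Pi_pmf {..<m} (0, False, False) (\<lambda>_. pair_pmf (binomial_pmf (k - 2) p) (pair_pmf b b))"
    unfolding col .
  let ?u = "\<lambda>h. (\<lambda>x. fst (h x), \<lambda>x. snd (h x))"
  have "pair_pmf (Pi_pmf {..<m} 0 (\<lambda>_. binomial_pmf (k - 2) p)) (pair_pmf Q Q) =
    pair_pmf (Pi_pmf {..<m} 0 (\<lambda>_. binomial_pmf (k - 2) p))
      (map_pmf ?u (Pi_pmf {..<m} (False, False) (\<lambda>_. pair_pmf b b)))"
    unfolding Q_def b_def by (subst Pi_pmf_pair_pmf) auto
  also have "\<dots> = map_pmf (apsnd ?u) (map_pmf ?u
      (Pi_pmf {..<m} (0, False, False) (\<lambda>_. pair_pmf (binomial_pmf (k - 2) p) (pair_pmf b b))))"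
    by (subst Pi_pmf_pair_pmf) (auto simp: pair_map_pmf2)
  also have "\<dots> = map_pmf (\<lambda>X. (\<lambda>j. card {i \<in> R. X (i, j)}, \<lambda>j. X (v, j), \<lambda>j. X (v', j))) (random_matrix k m p)"
    unfolding cols[symmetric] by (simp add: pmf.map_comp o_def g_def)
  finally show ?thesis unfolding R_def by simp
qed

section \<open>Asymptotic independence of two rows\<close>

text \<open>Chebyshev, with a fixed selector \<open>J\<close> that has two uses: constantly true it
  measures the density of a row, and equal to another row it measures the intersection with that
  row.\<close>

lemma prob_row_deviation:
  fixes p \<eta> :: real and m :: nat
  assumes p: "0 < p" "p < 1" and "\<eta> > 0" "m > 0"
  shows "measure_pmf.prob (Pi_pmf {..<m} False (\<lambda>_. bernoulli_pmf p))
     {A. \<bar>\<Sum>j<m. of_bool (J j) * (of_bool (A j) - p)\<bar> \<ge> \<eta> * m} \<le> 1 / (\<eta>\<^sup>2 * m)"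
proof -
  let ?Q = "Pi_pmf {..<m} False (\<lambda>_. bernoulli_pmf p)"
  let ?f = "\<lambda>j b. of_bool (J j) * (of_bool b - p) :: real"
  have fin: "finite (set_pmf ?Q)" by auto
  have "measure_pmf.expectation (bernoulli_pmf p) (\<lambda>b. (?f j b)\<^sup>2) \<le> 1" for j
  proof -
    have "measure_pmf.expectation (bernoulli_pmf p) (\<lambda>b. (?f j b)\<^sup>2) \<le> measure_pmf.expectation (bernoulli_pmf p) (\<lambda>b. 1)"
    proof (intro integral_mono integrable_measure_pmf_finite)
      fix b show "(?f j b)\<^sup>2 \<le> 1" using p by (auto simp: abs_square_le_1)
    qed auto
    then show ?thesis by simp
  qed
  then have "(\<Sum>j<m. measure_pmf.expectation (bernoulli_pmf p) (\<lambda>b. (?f j b)\<^sup>2)) \<le> m"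
    using sum_bounded_above[of "{..<m}" _ "1::real"] by simp
  moreover have "measure_pmf.expectation ?Q (\<lambda>A. (\<Sum>j<m. ?f j (A j))\<^sup>2) =
      (\<Sum>j<m. measure_pmf.expectation (bernoulli_pmf p) (\<lambda>b. (?f j b)\<^sup>2))"
    using p by (intro variance_sum_centered) (auto simp: algebra_simps)
  ultimately have E: "measure_pmf.expectation ?Q (\<lambda>A. (\<Sum>j<m. ?f j (A j))\<^sup>2) \<le> m" by simp
  have "{A. \<bar>\<Sum>j<m. ?f j (A j)\<bar> \<ge> \<eta> * m} = {A. (\<Sum>j<m. ?f j (A j))\<^sup>2 \<ge> (\<eta> * m)\<^sup>2}"
    using \<open>\<eta> > 0\<close> by (auto simp: abs_le_square_iff[symmetric])
  also have "measure_pmf.prob ?Q \<dots> \<le> measure_pmf.expectation ?Q (\<lambda>A. (\<Sum>j<m. ?f j (A j))\<^sup>2) / (\<eta> * m)\<^sup>2"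
    using assms by (intro pmf_Markov fin) auto
  also have "\<dots> \<le> m / (\<eta> * m)\<^sup>2" using E by (intro divide_right_mono) auto
  also have "\<dots> = 1 / (\<eta>\<^sup>2 * m)" using assms by (simp add: power2_eq_square)
  finally show ?thesis .
qed

definition typical_rows :: "real \<Rightarrow> nat \<Rightarrow> real \<Rightarrow> ((nat \<Rightarrow> bool) \<times> (nat \<Rightarrow> bool)) set" where
  "typical_rows p m \<eta> = {(A, B).
     \<bar>(\<Sum>j<m. of_bool (A j)) / m - p\<bar> < \<eta> \<and> \<bar>(\<Sum>j<m. of_bool (B j)) / m - p\<bar> < \<eta> \<and>
     \<bar>(\<Sum>j<m. of_bool (A j \<and> B j)) / m - p\<^sup>2\<bar> < \<eta>}"

text \<open>Given \<open>A\<close>, the intersection count is a selected sum over the independent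
  row \<open>B\<close>. Three deviation events at level \<eta> / 2 cost 4 / (\<eta>^2 m) each, which
  gives the 12.\<close>

lemma prob_atypical_rows:
  fixes p \<eta> :: real and m :: nat
  assumes p: "0 < p" "p < 1" and "\<eta> > 0" "m > 0"
  defines "Q \<equiv> Pi_pmf {..<m} False (\<lambda>_. bernoulli_pmf p)"
  shows "measure_pmf.prob (pair_pmf Q Q) (- typical_rows p m \<eta>) \<le> 12 / (\<eta>\<^sup>2 * m)"
proof -
  let ?s = "\<lambda>J A. \<Sum>j<m. of_bool (J j) * (of_bool (A j) - p) :: real"
  let ?dev = "\<lambda>J. {A. \<bar>?s J A\<bar> \<ge> \<eta> / 2 * m}"
  have fin: "finite (set_pmf Q)" unfolding Q_def by auto
  have dev: "measure_pmf.prob Q (?dev J) \<le> 4 / (\<eta>\<^sup>2 * m)" for J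
    using prob_row_deviation[OF p, of "\<eta> / 2" m J] assms(3,4) by (simp add: Q_def power_divide)
  have sub: "- typical_rows p m \<eta> \<subseteq> {(A, B). A \<in> ?dev (\<lambda>_. True) \<or> B \<in> ?dev (\<lambda>_. True) \<union> ?dev A}"
  proof (rule subsetI, rule ccontr)
    fix z assume z: "z \<in> - typical_rows p m \<eta>"
      "z \<notin> {(A, B). A \<in> ?dev (\<lambda>_. True) \<or> B \<in> ?dev (\<lambda>_. True) \<union> ?dev A}"
    obtain A B where AB: "z = (A, B)" by (cases z)
    have n: "(A, B) \<notin> typical_rows p m \<eta>" and
      "\<not> (A \<in> ?dev (\<lambda>_. True) \<or> B \<in> ?dev (\<lambda>_. True) \<union> ?dev A)"
      using z unfolding AB by (simp_all only: Compl_iff mem_Collect_eq prod.case not_False_eq_True)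
    then have d: "\<bar>?s (\<lambda>_. True) A\<bar> < \<eta> / 2 * m" "\<bar>?s (\<lambda>_. True) B\<bar> < \<eta> / 2 * m" "\<bar>?s A B\<bar> < \<eta> / 2 * m"
      by auto
    have T: "?s (\<lambda>_. True) X / m = (\<Sum>j<m. of_bool (X j)) / m - p" for X
      using \<open>m > 0\<close> by (simp add: sum_subtractf diff_divide_distrib)
    have "?s A B = (\<Sum>j<m. of_bool (A j \<and> B j) - p * of_bool (A j))"
      by (intro sum.cong) auto
    also have "\<dots> = (\<Sum>j<m. of_bool (A j \<and> B j)) - p * (\<Sum>j<m. of_bool (A j))"
      by (simp only: sum_subtractf sum_distrib_left)
    finally have sAB: "?s A B = (\<Sum>j<m. of_bool (A j \<and> B j)) - p * (\<Sum>j<m. of_bool (A j))" .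
    \<comment> \<open>The intersection density errs by its deviation given \<open>A\<close> plus p
      times the deviation of \<open>A\<close> itself; this is why deviations are taken at half of
      \<open>\<eta>\<close>.\<close>
    have "d / M - p\<^sup>2 = (d - p * a) / M + p * (a / M - p)" for d a M :: real
      by (simp add: diff_divide_distrib right_diff_distrib power2_eq_square)
    then have AB: "(\<Sum>j<m. of_bool (A j \<and> B j)) / m - p\<^sup>2 = ?s A B / m + p * (?s (\<lambda>_. True) A / m)"
      unfolding T sAB .
    have d': "\<bar>?s (\<lambda>_. True) A / m\<bar> < \<eta> / 2" "\<bar>?s (\<lambda>_. True) B / m\<bar> < \<eta> / 2" "\<bar>?s A B / m\<bar> < \<eta> / 2"
      using d \<open>m > 0\<close> by (simp_all only: abs_divide abs_of_nat pos_divide_less_eq of_nat_0_less_iff)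
    have "\<bar>p * (?s (\<lambda>_. True) A / m)\<bar> \<le> \<bar>?s (\<lambda>_. True) A / m\<bar>"
      unfolding abs_mult using p by (intro mult_left_le_one_le) auto
    then have "\<bar>(\<Sum>j<m. of_bool (A j \<and> B j)) / m - p\<^sup>2\<bar> < \<eta>"
      unfolding AB using d' by linarith
    moreover have "\<bar>(\<Sum>j<m. of_bool (A j)) / m - p\<bar> < \<eta>" "\<bar>(\<Sum>j<m. of_bool (B j)) / m - p\<bar> < \<eta>"
      using d' \<open>\<eta> > 0\<close> unfolding T by linarith+
    ultimately show False using n by (simp only: typical_rows_def mem_Collect_eq prod.case simp_thms)
  qed
  then have "measure_pmf.prob (pair_pmf Q Q) (- typical_rows p m \<eta>) \<le>
      measure_pmf.prob (pair_pmf Q Q) {(A, B). A \<in> ?dev (\<lambda>_. True) \<or> B \<in> ?dev (\<lambda>_. True) \<union> ?dev A}"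
    by (intro measure_pmf.finite_measure_mono) auto
  also have "\<dots> \<le> measure_pmf.prob Q (- (- ?dev (\<lambda>_. True))) + 8 / (\<eta>\<^sup>2 * m)"
  proof (rule prob_pair_pmf_le[OF fin fin])
    fix A assume "A \<in> - ?dev (\<lambda>_. True)"
    then have "{B. (A, B) \<in> {(A, B). A \<in> ?dev (\<lambda>_. True) \<or> B \<in> ?dev (\<lambda>_. True) \<union> ?dev A}} = ?dev (\<lambda>_. True) \<union> ?dev A"
      by blast
    moreover have "measure_pmf.prob Q (?dev (\<lambda>_. True) \<union> ?dev A) \<le> 4 / (\<eta>\<^sup>2 * m) + 4 / (\<eta>\<^sup>2 * m)"
      by (rule order_trans[OF measure_Un_le add_mono[OF dev dev]]) auto
    moreover have "4 / (\<eta>\<^sup>2 * m) + 4 / (\<eta>\<^sup>2 * m) = 8 / (\<eta>\<^sup>2 * m)"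
      by (simp flip: add_divide_distrib)
    ultimately show "measure_pmf.prob Q {B. (A, B) \<in> {(A, B). A \<in> ?dev (\<lambda>_. True) \<or> B \<in> ?dev (\<lambda>_. True) \<union> ?dev A}}
        \<le> 8 / (\<eta>\<^sup>2 * m)" by (simp only:)
  qed simp
  also have "\<dots> \<le> 12 / (\<eta>\<^sup>2 * m)"
  proof -
    have "4 / (\<eta>\<^sup>2 * m) + 8 / (\<eta>\<^sup>2 * m) = 12 / (\<eta>\<^sup>2 * m)"
      by (simp flip: add_divide_distrib)
    with dev[of "\<lambda>_. True"] show ?thesis unfolding double_complement by linarith
  qed
  finally show ?thesis .
qed

lemma groupie_threshold_near:
  fixes p c \<epsilon> :: real
  assumes p: "0 < p" "p < 1" and "\<epsilon> > 0"
  shows "\<exists>\<eta>>0. \<forall>\<rho> \<alpha> \<beta> \<gamma> \<kappa>. \<bar>\<rho> - 1/2\<bar> < \<eta> \<longrightarrow> \<bar>\<alpha> - p\<bar> < \<eta> \<longrightarrow> \<bar>\<beta> - p\<bar> < \<eta> \<longrightarrow>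
    \<bar>\<gamma> - p\<^sup>2\<bar> < \<eta> \<longrightarrow> \<bar>\<kappa> - p\<bar> < \<eta> \<longrightarrow>
    \<bar>groupie_threshold p c (\<rho>, \<alpha>, \<beta>, \<gamma>, \<kappa>) - (1 + p * c / (2 * (1 - p)))\<bar> < \<epsilon>"
proof -
  \<comment> \<open>The limits of the five arguments: balanced sides, row densities p, intersection
    density p^2 and mean column density p.\<close>
  let ?z = "(1/2, p, p, p\<^sup>2, p)"
  have val: "groupie_threshold p c ?z = 1 + p * c / (2 * (1 - p))"
    using p unfolding groupie_threshold_def by (simp add: field_simps power2_eq_square)
  have "isCont (groupie_threshold p c) ?z"
    unfolding groupie_threshold_def case_prod_beta using p by (intro continuous_intros) auto
  then obtain d where d: "d > 0" "\<And>z. dist z ?z < d \<Longrightarrow> dist (groupie_threshold p c z) (groupie_threshold p c ?z) < \<epsilon>"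
    using \<open>\<epsilon> > 0\<close> unfolding continuous_at_eps_delta by blast
  have pair: "dist (x, y) (x', y') \<le> dist x x' + dist y y'"
    for x x' :: real and y y' :: "'a::metric_space"
    unfolding dist_Pair_Pair by (rule sqrt_sum_squares_le_sum) auto
  show ?thesis
  \<comment> \<open>One fifth for each of the five coordinates, as the product distance is at most
    the sum of the coordinate distances.\<close>
  proof (intro exI[of _ "d / 5"] conjI allI impI)
    fix \<rho> \<alpha> \<beta> \<gamma> \<kappa> :: real
    assume "\<bar>\<rho> - 1/2\<bar> < d / 5" "\<bar>\<alpha> - p\<bar> < d / 5" "\<bar>\<beta> - p\<bar> < d / 5" "\<bar>\<gamma> - p\<^sup>2\<bar> < d / 5" "\<bar>\<kappa> - p\<bar> < d / 5"
    moreover have "dist (\<rho>, \<alpha>, \<beta>, \<gamma>, \<kappa>) ?z \<le> dist \<rho> (1/2) + (dist \<alpha> p + (dist \<beta> p + (dist \<gamma> (p\<^sup>2) + dist \<kappa> p)))"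
      by (intro order_trans[OF pair] add_left_mono order_refl)
    ultimately have "dist (\<rho>, \<alpha>, \<beta>, \<gamma>, \<kappa>) ?z < d"
      unfolding dist_real_def by linarith
    from d(2)[OF this] show "\<bar>groupie_threshold p c (\<rho>, \<alpha>, \<beta>, \<gamma>, \<kappa>) - (1 + p * c / (2 * (1 - p)))\<bar> < \<epsilon>"
      by (simp add: val dist_real_def)
  qed (use d in auto)
qed

section \<open>Scores of the rows and their conditional independence\<close>

definition row_score :: "real \<Rightarrow> nat \<Rightarrow> (nat \<Rightarrow> nat) \<Rightarrow> (nat \<Rightarrow> bool) \<Rightarrow> real" where
  "row_score p m C A = (\<Sum>j<m. column_weight p m C j * (of_bool (A j) - p))"

lemma row_score_CLT:
  fixes p x \<epsilon> :: real
  assumes p: "0 < p" "p < 1" and "\<epsilon> > 0"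
  shows "\<exists>\<delta>>0. \<forall>m. \<forall>C\<in>typical_columns p m \<delta>.
     \<bar>measure_pmf.prob (Pi_pmf {..<m} False (\<lambda>_. bernoulli_pmf p)) {A. row_score p m C A \<le> x} - std_normal_cdf x\<bar> < \<epsilon>"
  using weighted_bernoulli_CLT[OF assms, of x] unfolding typical_columns_def row_score_def by blast

lemma typical_columns_mono: "\<delta> \<le> \<delta>' \<Longrightarrow> typical_columns p m \<delta> \<subseteq> typical_columns p m \<delta>'"
  unfolding typical_columns_def by auto

text \<open>Both rows are left out, so the same counts serve v and v' and are independent of both
  rows.\<close>

definition other_columns :: "nat \<Rightarrow> nat \<Rightarrow> nat \<Rightarrow> (nat \<times> nat \<Rightarrow> bool) \<Rightarrow> nat \<Rightarrow> nat" where
  "other_columns k v v' X = (\<lambda>j. card {i \<in> {..<k} - {v, v'}. X (i, j)})"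

text \<open>For typical data the random threshold is within \<open>h\<close> of \<open>t\<close>, so
  the two conditions can disagree only if the score lies between t - h and t + h. The normal
  approximation at both ends bounds the probability of this window by an increment of \<Phi> plus
  two errors.\<close>

lemma groupie_score_mismatch:
  fixes p e :: real and c :: int
  assumes p: "0 < p" "p < 1" and e: "e > 0"
  defines "t \<equiv> 1 + p * real_of_int c / (2 * (1 - p))"
  shows "\<exists>M. \<forall>m\<ge>M. \<forall>k. int k - int m = c \<longrightarrow> (\<forall>v<k. \<forall>v'<k. v \<noteq> v' \<longrightarrow>
    measure_pmf.prob (random_matrix k m p)
      {X. groupie (bip_verts k m) (bip_graph k m X) (Inl v) \<noteq>
          (row_score p m (other_columns k v v' X) (\<lambda>j. X (v, j)) \<le> t)} \<le> e)"
proof -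
  \<comment> \<open>Six shares: two for the increment of \<Phi> over the window, two for the normal
    approximations at its ends, one for atypical rows and one for atypical columns.\<close>
  define e' where "e' = e / 6"
  have e': "e' > 0" using e by (simp add: e'_def)
  obtain d where d: "d > 0" "\<And>y. \<bar>y - t\<bar> < d \<Longrightarrow> \<bar>std_normal_cdf y - std_normal_cdf t\<bar> < e'"
    using continuous_std_normal_cdf[of t] e' unfolding continuous_at_eps_delta dist_real_def by blast
  define h where "h = d / 2"
  have h: "h > 0" "std_normal_cdf (t + h) - std_normal_cdf (t - h) < 2 * e'"
    using d(1) d(2)[of "t + h"] d(2)[of "t - h"] by (auto simp: h_def)
  obtain \<delta>1 where \<delta>1: "\<delta>1 > 0" "\<And>m C. C \<in> typical_columns p m \<delta>1 \<Longrightarrow>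
     \<bar>measure_pmf.prob (Pi_pmf {..<m} False (\<lambda>_. bernoulli_pmf p)) {A. row_score p m C A \<le> t + h} - std_normal_cdf (t + h)\<bar> < e'"
    using row_score_CLT[OF p e'] by metis
  obtain \<delta>2 where \<delta>2: "\<delta>2 > 0" "\<And>m C. C \<in> typical_columns p m \<delta>2 \<Longrightarrow>
     \<bar>measure_pmf.prob (Pi_pmf {..<m} False (\<lambda>_. bernoulli_pmf p)) {A. row_score p m C A \<le> t - h} - std_normal_cdf (t - h)\<bar> < e'"
    using row_score_CLT[OF p e'] by metis
  obtain \<eta>0 where \<eta>0: "\<eta>0 > 0" "\<And>\<rho> \<alpha> \<beta> \<gamma> \<kappa>. \<bar>\<rho> - 1/2\<bar> < \<eta>0 \<Longrightarrow> \<bar>\<alpha> - p\<bar> < \<eta>0 \<Longrightarrow> \<bar>\<beta> - p\<bar> < \<eta>0 \<Longrightarrow>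
    \<bar>\<gamma> - p\<^sup>2\<bar> < \<eta>0 \<Longrightarrow> \<bar>\<kappa> - p\<bar> < \<eta>0 \<Longrightarrow> \<bar>groupie_threshold p c (\<rho>, \<alpha>, \<beta>, \<gamma>, \<kappa>) - t\<bar> < h"
    using groupie_threshold_near[OF p h(1), of "real_of_int c"] unfolding t_def by blast
  define \<delta> where "\<delta> = min (min \<delta>1 \<delta>2) (min \<eta>0 e')"
  \<comment> \<open>Capping at p makes every typical row nonempty, so v is not isolated and the
    threshold criterion applies.\<close>
  define \<eta> where "\<eta> = min \<eta>0 p"
  have \<delta>: "\<delta> > 0" "\<delta> \<le> \<delta>1" "\<delta> \<le> \<delta>2" "\<delta> \<le> \<eta>0" "\<delta> \<le> e'" and \<eta>: "\<eta> > 0" "\<eta> \<le> \<eta>0" "\<eta> \<le> p"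
    using \<delta>1 \<delta>2 \<eta>0 e' p by (auto simp: \<delta>_def \<eta>_def)
  \<comment> \<open>The summand 2 accounts for the removed rows: the counts are binomial with K = k
    - 2 trials.\<close>
  obtain M1 where M1: "\<And>m K. m \<ge> M1 \<Longrightarrow> \<bar>real K - real m\<bar> \<le> \<bar>real_of_int c\<bar> + 2 \<Longrightarrow>
    measure_pmf.prob (Pi_pmf {..<m} 0 (\<lambda>_. binomial_pmf K p)) (- typical_columns p m \<delta>) \<le> \<delta>"
    using prob_atypical_columns[OF p \<delta>(1), of "\<bar>real_of_int c\<bar> + 2"] by blast
  \<comment> \<open>The terms give k \<ge> 2, bring m / (k + m) within \<open>\<eta>0\<close> of
    1/2, and push the probability of atypical rows below \<open>e'\<close>.\<close>
  obtain M2 :: nat where M2: "real M2 > 3 + \<bar>real_of_int c\<bar> + \<bar>real_of_int c\<bar> / \<eta>0 + 12 / (\<eta>\<^sup>2 * e')"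
    using reals_Archimedean2 by blast
  have "measure_pmf.prob (random_matrix k m p)
      {X. groupie (bip_verts k m) (bip_graph k m X) (Inl v) \<noteq>
          (row_score p m (other_columns k v v' X) (\<lambda>j. X (v, j)) \<le> t)} \<le> e"
    if m: "m \<ge> max M1 M2" and c: "int k - int m = c" and v: "v < k" "v' < k" "v \<noteq> v'" for m k v v'
  proof -
    have "real m \<ge> real M2" using m by simp
    moreover have "\<bar>real_of_int c\<bar> / \<eta>0 \<ge> 0" "12 / (\<eta>\<^sup>2 * e') \<ge> 0" using \<eta>0 e' by auto
    ultimately have m': "real m > 3 + \<bar>real_of_int c\<bar>" "real m > \<bar>real_of_int c\<bar> / \<eta>0" "real m > 12 / (\<eta>\<^sup>2 * e')"
      using M2 by linarith+
    have kc: "real k - real m = real_of_int c" using c by (metis of_int_diff of_int_of_nat_eq)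
    have k2: "k \<ge> 2" using kc m' by linarith
    have m0: "m > 0" using m' by linarith
    have small: "12 / (\<eta>\<^sup>2 * m) \<le> e'"
    proof -
      have "12 < m * (\<eta>\<^sup>2 * e')" using m'(3) \<eta>(1) e' by (simp add: divide_less_eq)
      then show ?thesis using m0 \<eta>(1) by (simp add: divide_le_eq mult_ac)
    qed
    have \<rho>: "\<bar>real m / (real k + real m) - 1/2\<bar> < \<eta>0"
    proof -
      have n: "real k + real m > real m" using k2 by simp
      have "real m / (real k + real m) - 1/2 = - (real_of_int c / (2 * (real k + real m)))"
        unfolding kc[symmetric] using n by (simp add: field_simps)
      also have "\<bar>\<dots>\<bar> = \<bar>real_of_int c\<bar> / (2 * (real k + real m))" using n by (simp add: abs_divide)
      also have "\<dots> \<le> \<bar>real_of_int c\<bar> / m" using n m0 by (intro divide_left_mono) auto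
      also have "\<dots> < \<eta>0" using m'(2) \<eta>0(1) m0 by (simp add: divide_less_eq mult.commute)
      finally show ?thesis .
    qed
    define Q where "Q = Pi_pmf {..<m} False (\<lambda>_. bernoulli_pmf p)"
    define D where "D = Pi_pmf {..<m} 0 (\<lambda>_. binomial_pmf (k - 2) p)"
    have fin: "finite (set_pmf Q)" "finite (set_pmf (pair_pmf Q Q))" "finite (set_pmf D)"
      unfolding Q_def D_def set_pair_pmf using p by (auto intro!: finite_cartesian_product)
    let ?f = "\<lambda>X. (other_columns k v v' X, \<lambda>j. X (v, j), \<lambda>j. X (v', j))"
    have law: "map_pmf ?f (random_matrix k m p) = pair_pmf D (pair_pmf Q Q)"
      unfolding other_columns_def D_def Q_def by (rule random_matrix_two_rows[OF p v])
    define U where "U = (\<lambda>C. {A. t - h < row_score p m C A \<and> row_score p m C A \<le> t + h})"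
    define R where "R = {(C, A, B). C \<notin> typical_columns p m \<delta> \<or> (A, B) \<notin> typical_rows p m \<eta> \<or> A \<in> U C}"
    have "{X. groupie (bip_verts k m) (bip_graph k m X) (Inl v) \<noteq>
          (row_score p m (other_columns k v v' X) (\<lambda>j. X (v, j)) \<le> t)} \<subseteq> ?f -` R"
    proof (rule subsetI, rule ccontr)
      fix X assume X: "X \<in> {X. groupie (bip_verts k m) (bip_graph k m X) (Inl v) \<noteq>
          (row_score p m (other_columns k v v' X) (\<lambda>j. X (v, j)) \<le> t)}" "X \<notin> ?f -` R"
      let ?A = "\<lambda>j. X (v, j)" and ?B = "\<lambda>j. X (v', j)" and ?C = "other_columns k v v' X"
      have C: "?C \<in> typical_columns p m \<delta>" and AB: "(?A, ?B) \<in> typical_rows p m \<eta>" and U: "?A \<notin> U ?C"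
        using X(2) by (auto simp: R_def)
      have ab: "\<bar>(\<Sum>j<m. of_bool (?A j)) / m - p\<bar> < \<eta>" "\<bar>(\<Sum>j<m. of_bool (?B j)) / m - p\<bar> < \<eta>"
        "\<bar>(\<Sum>j<m. of_bool (?A j \<and> ?B j)) / m - p\<^sup>2\<bar> < \<eta>"
        using AB by (simp_all only: typical_rows_def mem_Collect_eq prod.case)
      have \<kappa>: "\<bar>(\<Sum>j<m. real (?C j)) / m / m - p\<bar> < \<delta>"
        using C by (simp add: typical_columns_def)
      have "(\<Sum>j<m. of_bool (?A j)) / m > (0::real)" using ab(1) \<eta>(3) by linarith
      then have pos: "(\<Sum>j<m. of_bool (?A j)) > (0::real)" using m0 by (simp add: zero_less_divide_iff)
      let ?thr = "groupie_threshold p c (real m / (real k + real m), (\<Sum>j<m. of_bool (?A j)) / m, (\<Sum>j<m. of_bool (?B j)) / m,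
          (\<Sum>j<m. of_bool (?A j \<and> ?B j)) / m, (\<Sum>j<m. real (?C j)) / m / m)"
      have "groupie (bip_verts k m) (bip_graph k m X) (Inl v) \<longleftrightarrow> row_score p m ?C ?A \<le> ?thr"
        using groupie_iff_threshold[OF p v m0 kc pos] unfolding row_score_def other_columns_def of_nat_add .
      then have neq: "row_score p m ?C ?A \<le> ?thr \<longleftrightarrow> \<not> row_score p m ?C ?A \<le> t"
        using X(1) by blast
      have "\<bar>?thr - t\<bar> < h"
      proof (rule \<eta>0(2)[OF \<rho>])
        show "\<bar>(\<Sum>j<m. of_bool (?A j)) / m - p\<bar> < \<eta>0" "\<bar>(\<Sum>j<m. of_bool (?B j)) / m - p\<bar> < \<eta>0"
          "\<bar>(\<Sum>j<m. of_bool (?A j \<and> ?B j)) / m - p\<^sup>2\<bar> < \<eta>0"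
          by (rule less_le_trans[OF ab(1) \<eta>(2)] less_le_trans[OF ab(2) \<eta>(2)] less_le_trans[OF ab(3) \<eta>(2)])+
        show "\<bar>(\<Sum>j<m. real (?C j)) / m / m - p\<bar> < \<eta>0"
          by (rule less_le_trans[OF \<kappa> \<delta>(4)])
      qed
      moreover have "row_score p m ?C ?A \<le> t - h \<or> row_score p m ?C ?A > t + h"
        using U unfolding U_def mem_Collect_eq by argo
      ultimately show False using neq h(1) by argo
    qed
    then have "measure_pmf.prob (random_matrix k m p)
      {X. groupie (bip_verts k m) (bip_graph k m X) (Inl v) \<noteq>
          (row_score p m (other_columns k v v' X) (\<lambda>j. X (v, j)) \<le> t)} \<le>
      measure_pmf.prob (random_matrix k m p) (?f -` R)"
      by (intro measure_pmf.finite_measure_mono) auto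
    also have "\<dots> = measure_pmf.prob (pair_pmf D (pair_pmf Q Q)) R"
      unfolding law[symmetric] by simp
    also have "\<dots> \<le> measure_pmf.prob D (- typical_columns p m \<delta>) + 5 * e'"
    proof (rule prob_pair_pmf_le[OF fin(3) fin(2)])
      fix C assume C: "C \<in> typical_columns p m \<delta>"
      let ?P = "\<lambda>x. measure_pmf.prob Q {A. row_score p m C A \<le> x}"
      have "U C = {A. row_score p m C A \<le> t + h} - {A. row_score p m C A \<le> t - h}"
        unfolding U_def by auto
      then have "measure_pmf.prob Q (U C) = ?P (t + h) - ?P (t - h)"
        using h(1) by (simp add: measure_pmf.finite_measure_Diff Collect_mono)
      also have "\<dots> < (std_normal_cdf (t + h) + e') - (std_normal_cdf (t - h) - e')"
        using \<delta>1(2)[of C m] \<delta>2(2)[of C m] C typical_columns_mono[OF \<delta>(2)] typical_columns_mono[OF \<delta>(3)]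
        unfolding Q_def[symmetric] by fastforce
      also have "\<dots> \<le> 4 * e'" using h(2) by linarith
      finally have PU: "measure_pmf.prob Q (U C) \<le> 4 * e'" by simp
      have "{y. (C, y) \<in> R} = - typical_rows p m \<eta> \<union> fst -` U C"
        using C by (auto simp: R_def)
      also have "measure_pmf.prob (pair_pmf Q Q) \<dots> \<le>
          measure_pmf.prob (pair_pmf Q Q) (- typical_rows p m \<eta>) + measure_pmf.prob (pair_pmf Q Q) (fst -` U C)"
        by (rule measure_Un_le) auto
      also have "measure_pmf.prob (pair_pmf Q Q) (fst -` U C) = measure_pmf.prob Q (U C)"
        using measure_map_pmf[of fst "pair_pmf Q Q" "U C"] by (simp add: map_fst_pair_pmf)
      also have "measure_pmf.prob (pair_pmf Q Q) (- typical_rows p m \<eta>) \<le> 12 / (\<eta>\<^sup>2 * m)"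
        unfolding Q_def by (rule prob_atypical_rows[OF p \<eta>(1) m0])
      finally show "measure_pmf.prob (pair_pmf Q Q) {y. (C, y) \<in> R} \<le> 5 * e'"
        using PU small by linarith
    qed (use e' in simp)
    also have "measure_pmf.prob D (- typical_columns p m \<delta>) \<le> \<delta>"
      unfolding D_def
    proof (rule M1)
      show "\<bar>real (k - 2) - real m\<bar> \<le> \<bar>real_of_int c\<bar> + 2"
        using k2 kc by (simp add: of_nat_diff)
    qed (use m in simp)
    finally show ?thesis using \<delta>(5) by (simp add: e'_def)
  qed
  then show ?thesis by blast
qed

text \<open>Given the column counts \<open>C\<close>, the rows of v and v' are independent with the
  same law, so the conditional expectation of the product is the square of P(score \<le> t | C) - a.
  It is small for typical \<open>C\<close> and at most 1 otherwise.\<close>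

lemma row_score_correlation:
  fixes p e t :: real and c :: int
  assumes p: "0 < p" "p < 1" and e: "e > 0"
  defines "a \<equiv> std_normal_cdf t"
  shows "\<exists>M. \<forall>m\<ge>M. \<forall>k. int k - int m = c \<longrightarrow> (\<forall>v<k. \<forall>v'<k. v \<noteq> v' \<longrightarrow>
    measure_pmf.expectation (random_matrix k m p)
      (\<lambda>X. (of_bool (row_score p m (other_columns k v v' X) (\<lambda>j. X (v, j)) \<le> t) - a) *
           (of_bool (row_score p m (other_columns k v v' X) (\<lambda>j. X (v', j)) \<le> t) - a)) \<le> e)"
proof -
  \<comment> \<open>The cap at 1 allows bounding the squared error by \<open>e'\<close>; the halves
    are for typical and atypical columns.\<close>
  define e' where "e' = min 1 (e / 2)"
  have e': "e' > 0" "e' \<le> 1" "2 * e' \<le> e" using e by (simp_all add: e'_def)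
  obtain \<delta>1 where \<delta>1: "\<delta>1 > 0" "\<And>m C. C \<in> typical_columns p m \<delta>1 \<Longrightarrow>
     \<bar>measure_pmf.prob (Pi_pmf {..<m} False (\<lambda>_. bernoulli_pmf p)) {A. row_score p m C A \<le> t} - a\<bar> < e'"
    using row_score_CLT[OF p e'(1)] unfolding a_def by metis
  define \<delta> where "\<delta> = min \<delta>1 e'"
  have \<delta>: "\<delta> > 0" "\<delta> \<le> \<delta>1" "\<delta> \<le> e'" using \<delta>1 e' by (auto simp: \<delta>_def)
  obtain M1 where M1: "\<And>m K. m \<ge> M1 \<Longrightarrow> \<bar>real K - real m\<bar> \<le> \<bar>real_of_int c\<bar> + 2 \<Longrightarrow>
    measure_pmf.prob (Pi_pmf {..<m} 0 (\<lambda>_. binomial_pmf K p)) (- typical_columns p m \<delta>) \<le> \<delta>"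
    using prob_atypical_columns[OF p \<delta>(1), of "\<bar>real_of_int c\<bar> + 2"] by blast
  have "measure_pmf.expectation (random_matrix k m p)
      (\<lambda>X. (of_bool (row_score p m (other_columns k v v' X) (\<lambda>j. X (v, j)) \<le> t) - a) *
           (of_bool (row_score p m (other_columns k v v' X) (\<lambda>j. X (v', j)) \<le> t) - a)) \<le> e"
    if m: "m \<ge> M1" and c: "int k - int m = c" and v: "v < k" "v' < k" "v \<noteq> v'" for m k v v'
  proof -
    define Q where "Q = Pi_pmf {..<m} False (\<lambda>_. bernoulli_pmf p)"
    define D where "D = Pi_pmf {..<m} 0 (\<lambda>_. binomial_pmf (k - 2) p)"
    have fin: "finite (set_pmf Q)" "finite (set_pmf (pair_pmf Q Q))" "finite (set_pmf D)"
      unfolding Q_def D_def set_pair_pmf using p by (auto intro!: finite_cartesian_product)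
    note int = integrable_measure_pmf_finite[OF fin(1)] integrable_measure_pmf_finite[OF fin(3)]
    let ?f = "\<lambda>X. (other_columns k v v' X, \<lambda>j. X (v, j), \<lambda>j. X (v', j))"
    have law: "map_pmf ?f (random_matrix k m p) = pair_pmf D (pair_pmf Q Q)"
      unfolding other_columns_def D_def Q_def by (rule random_matrix_two_rows[OF p v])
    let ?j = "\<lambda>C A. of_bool (row_score p m C A \<le> t) - a :: real"
    let ?h = "\<lambda>C. measure_pmf.prob Q {A. row_score p m C A \<le> t} - a"
    have Ej: "measure_pmf.expectation Q (?j C) = ?h C" for C
    proof -
      have "(\<lambda>A. of_bool (row_score p m C A \<le> t) :: real) = indicator {A. row_score p m C A \<le> t}"
        by (auto simp: indicator_def)
      then show ?thesis by (simp add: int)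
    qed
    have "measure_pmf.expectation (random_matrix k m p)
      (\<lambda>X. ?j (other_columns k v v' X) (\<lambda>j. X (v, j)) * ?j (other_columns k v v' X) (\<lambda>j. X (v', j))) =
      measure_pmf.expectation (pair_pmf D (pair_pmf Q Q)) (\<lambda>(C, A, B). ?j C A * ?j C B)"
      unfolding law[symmetric] by simp
    also have "\<dots> = measure_pmf.expectation D (\<lambda>C. (?h C)\<^sup>2)"
      using fin by (simp add: expectation_pair_pmf Ej power2_eq_square)
    also have "\<dots> \<le> measure_pmf.expectation D (\<lambda>C. e' + indicator (- typical_columns p m \<delta>) C)"
    proof (intro integral_mono int)
      fix C
      have "\<bar>?h C\<bar> \<le> 1"
        using std_normal_cdf_bounds[of t] measure_pmf.prob_le_1[of Q "{A. row_score p m C A \<le> t}"]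
          measure_nonneg[of Q "{A. row_score p m C A \<le> t}"] unfolding a_def by linarith
      then have 1: "(?h C)\<^sup>2 \<le> 1" by (simp add: abs_square_le_1)
      have 2: "(?h C)\<^sup>2 \<le> e'" if "C \<in> typical_columns p m \<delta>"
      proof -
        have "\<bar>?h C\<bar> \<le> e'" using \<delta>1(2)[of C m] that typical_columns_mono[OF \<delta>(2)]
          unfolding Q_def by (meson less_imp_le subsetD)
        then have "\<bar>?h C\<bar>\<^sup>2 \<le> e'\<^sup>2" by (intro power_mono) auto
        also have "\<dots> \<le> e'" using e' by (simp add: power2_eq_square mult_left_le)
        finally show ?thesis by simp
      qed
      show "(?h C)\<^sup>2 \<le> e' + indicator (- typical_columns p m \<delta>) C"
        using 1 2 e' by (cases "C \<in> typical_columns p m \<delta>") auto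
    qed
    also have "\<dots> = e' + measure_pmf.prob D (- typical_columns p m \<delta>)"
      by (simp add: int)
    also have "measure_pmf.prob D (- typical_columns p m \<delta>) \<le> \<delta>"
      unfolding D_def
    proof (rule M1)
      have "real k - real m = real_of_int c" using c by (metis of_int_diff of_int_of_nat_eq)
      then show "\<bar>real (k - 2) - real m\<bar> \<le> \<bar>real_of_int c\<bar> + 2"
        using v by (simp add: of_nat_diff)
    qed (use m in simp)
    finally show ?thesis using \<delta>(3) e'(3) by linarith
  qed
  then show ?thesis by blast
qed

section \<open>Concentration of the number of groupies\<close>

text \<open>All factors lie in [-1, 1], and switching one indicator moves its factor by at most 1,
  so the indicators can be exchanged one after the other at unit cost.\<close>

lemma of_bool_product_perturb:
  fixes a :: real
  assumes "0 \<le> a" "a \<le> 1"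
  shows "(of_bool G - a) * (of_bool G' - a) \<le> (of_bool J - a) * (of_bool J' - a) + of_bool (G \<noteq> J) + of_bool (G' \<noteq> J')"
  using assms mult_nonneg_nonneg[of a a] mult_left_le[of a a] mult_nonneg_nonneg[of "1 - a" "1 - a"]
    mult_nonneg_nonneg[of a "1 - a"]
  by (cases G; cases G'; cases J; cases J') (simp_all add: algebra_simps)

text \<open>The second moment is taken about the limit \<open>a\<close> and not about the mean, so
  bounds on pairs of vertices suffice and no separate convergence of the mean is needed. An
  off-diagonal pair contributes at most 3 e': the score correlation and two mismatches.\<close>

lemma left_groupies_concentration:
  fixes p \<epsilon> e :: real and c :: int
  assumes p: "0 < p" "p < 1" and "\<epsilon> > 0" "e > 0"
  defines "a \<equiv> std_normal_cdf (1 + p * real_of_int c / (2 * (1 - p)))"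
  shows "\<exists>M. \<forall>m\<ge>M. \<forall>k. int k - int m = c \<longrightarrow>
    measure_pmf.prob (random_bipartite k m p)
      {E. \<bar>real (card {v. v < k \<and> groupie (bip_verts k m) E (Inl v)}) / real k - a\<bar> > \<epsilon>} \<le> e"
proof -
  \<comment> \<open>The second moment will be at most 1 / k + 3 e' \<le> 4 e', and Markov divides it
    by \<epsilon>^2.\<close>
  define e' where "e' = e * \<epsilon>\<^sup>2 / 4"
  have e': "e' > 0" using assms by (simp add: e'_def)
  define t where "t = 1 + p * real_of_int c / (2 * (1 - p))"
  have a: "0 \<le> a" "a \<le> 1" unfolding a_def by (rule std_normal_cdf_bounds)+
  let ?G = "\<lambda>k m v X. groupie (bip_verts k m) (bip_graph k m X) (Inl v)"
  let ?J = "\<lambda>k m v v' X. row_score p m (other_columns k v v' X) (\<lambda>j. X (v, j)) \<le> t"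
  obtain M1 where M1: "\<forall>m\<ge>M1. \<forall>k. int k - int m = c \<longrightarrow> (\<forall>v<k. \<forall>v'<k. v \<noteq> v' \<longrightarrow>
      measure_pmf.prob (random_matrix k m p) {X. ?G k m v X \<noteq> ?J k m v v' X} \<le> e')"
    using groupie_score_mismatch[OF p e', of c, folded t_def] by (rule exE)
  obtain M2 where M2: "\<forall>m\<ge>M2. \<forall>k. int k - int m = c \<longrightarrow> (\<forall>v<k. \<forall>v'<k. v \<noteq> v' \<longrightarrow>
      measure_pmf.expectation (random_matrix k m p) (\<lambda>X. (of_bool (?J k m v v' X) - a) *
        (of_bool (row_score p m (other_columns k v v' X) (\<lambda>j. X (v', j)) \<le> t) - a)) \<le> e')"
    using row_score_correlation[OF p e', of c t, folded a_def[folded t_def]] by (rule exE)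
  obtain M3 :: nat where M3: "real M3 > \<bar>real_of_int c\<bar> + 1 / e'"
    using reals_Archimedean2 by blast
  have "measure_pmf.prob (random_bipartite k m p)
      {E. \<bar>real (card {v. v < k \<and> groupie (bip_verts k m) E (Inl v)}) / real k - a\<bar> > \<epsilon>} \<le> e"
    if m: "m \<ge> max M1 (max M2 M3)" and c: "int k - int m = c" for m k
  proof -
    let ?P = "random_matrix k m p"
    let ?g = "\<lambda>v X. of_bool (?G k m v X) - a :: real"
    have fin: "finite (set_pmf ?P)" unfolding random_matrix_def by auto
    note int = integrable_measure_pmf_finite[OF fin]
    have "real k - real m = real_of_int c" using c by (metis of_int_diff of_int_of_nat_eq)
    moreover have "real m \<ge> real M3" using m by simp
    ultimately have k: "real k > 1 / e'" using M3 by linarith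
    moreover have "1 / e' > 0" using e' by simp
    ultimately have k0: "real k > 0" by linarith
    have pair: "measure_pmf.expectation ?P (\<lambda>X. ?g v X * ?g v' X) \<le> of_bool (v = v') + 3 * e'"
      if v: "v < k" "v' < k" for v v'
    proof (cases "v = v'")
      case True
      have "measure_pmf.expectation ?P (\<lambda>X. ?g v X * ?g v' X) \<le> measure_pmf.expectation ?P (\<lambda>X. 1)"
      proof (intro integral_mono int)
        fix X
        have "\<bar>?g v X\<bar> \<le> 1" "\<bar>?g v' X\<bar> \<le> 1" using a by auto
        then have "\<bar>?g v X * ?g v' X\<bar> \<le> 1" unfolding abs_mult by (intro mult_le_one) auto
        then show "?g v X * ?g v' X \<le> 1" by linarith
      qed
      then show ?thesis using True e' by simp
    next
      case False
      \<comment> \<open>The symmetry lets the mismatch bound for (v', v) and the correlation bound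
        for (v, v') refer to the same scores.\<close>
      have swap: "other_columns k v' v = other_columns k v v'"
        unfolding other_columns_def by (simp add: insert_commute)
      let ?j = "\<lambda>v v' X. of_bool (?J k m v v' X) - a :: real"
      let ?ne = "\<lambda>v v'. {X. ?G k m v X \<noteq> ?J k m v v' X}"
      have "measure_pmf.expectation ?P (\<lambda>X. ?g v X * ?g v' X) \<le>
          measure_pmf.expectation ?P (\<lambda>X. ?j v v' X * ?j v' v X + indicator (?ne v v') X + indicator (?ne v' v) X)"
      proof (intro integral_mono int)
        fix X
        show "?g v X * ?g v' X \<le> ?j v v' X * ?j v' v X + indicator (?ne v v') X + indicator (?ne v' v) X"
          using of_bool_product_perturb[OF a, of "?G k m v X" "?G k m v' X" "?J k m v v' X" "?J k m v' v X"]
          by (simp add: indicator_def of_bool_def)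
      qed
      also have "\<dots> = measure_pmf.expectation ?P (\<lambda>X. ?j v v' X * ?j v' v X)
          + measure_pmf.prob ?P (?ne v v') + measure_pmf.prob ?P (?ne v' v)"
        by (simp add: int)
      also have "\<dots> \<le> e' + e' + e'"
      proof (intro add_mono)
        show "measure_pmf.expectation ?P (\<lambda>X. ?j v v' X * ?j v' v X) \<le> e'"
          unfolding swap using m by (intro M2[rule_format] c v False) simp
        show "measure_pmf.prob ?P (?ne v v') \<le> e'" using m by (intro M1[rule_format] c v False) simp
        show "measure_pmf.prob ?P (?ne v' v) \<le> e'" using m False by (intro M1[rule_format] c v) auto
      qed
      finally show ?thesis using False by simp
    qed
    let ?N = "\<lambda>X. card {v. v < k \<and> ?G k m v X}"
    have N: "(real (?N X) / real k - a)\<^sup>2 = (\<Sum>v<k. \<Sum>v'<k. ?g v X * ?g v' X) / (real k)\<^sup>2" for X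
    proof -
      have "(\<Sum>v<k. ?g v X) = real (?N X) - k * a"
        by (simp add: sum_subtractf Int_def)
      then have "real (?N X) / real k - a = (\<Sum>v<k. ?g v X) / real k"
        using k0 by (simp add: diff_divide_distrib)
      then show ?thesis by (simp only: power_divide power2_eq_square[of "\<Sum>v<k. ?g v X"] sum_product)
    qed
    have "measure_pmf.expectation ?P (\<lambda>X. (real (?N X) / real k - a)\<^sup>2) =
        (\<Sum>v<k. \<Sum>v'<k. measure_pmf.expectation ?P (\<lambda>X. ?g v X * ?g v' X)) / (real k)\<^sup>2"
      unfolding N by (simp only: Bochner_Integration.integral_divide_zero Bochner_Integration.integral_sum[OF int])
    also have "\<dots> \<le> (\<Sum>v<k. \<Sum>v'<k. of_bool (v = v') + 3 * e') / (real k)\<^sup>2"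
      by (intro divide_right_mono sum_mono pair) auto
    also have "(\<Sum>v<k. \<Sum>v'<k. of_bool (v = v') + 3 * e') = k + k * (k * (3 * e'))"
    proof -
      have "(\<Sum>v'<k. of_bool (v = v') :: real) = 1" if "v < k" for v
        using that by (simp add: of_bool_def)
      then show ?thesis by (simp add: sum.distrib distrib_left)
    qed
    also have "(k + k * (k * (3 * e'))) / (real k)\<^sup>2 = 1 / k + 3 * e'"
      using k0 by (simp add: power2_eq_square add_divide_distrib)
    also have "1 / k \<le> e'" using k k0 e' by (simp add: field_simps)
    finally have E: "measure_pmf.expectation ?P (\<lambda>X. (real (?N X) / real k - a)\<^sup>2) \<le> 4 * e'" by simp
    have "measure_pmf.prob (random_bipartite k m p)
        {E. \<bar>real (card {v. v < k \<and> groupie (bip_verts k m) E (Inl v)}) / real k - a\<bar> > \<epsilon>} =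
      measure_pmf.prob ?P {X. \<bar>real (?N X) / real k - a\<bar> > \<epsilon>}"
      unfolding random_bipartite_eq_random_matrix by simp
    also have "\<dots> \<le> measure_pmf.prob ?P {X. (real (?N X) / real k - a)\<^sup>2 \<ge> \<epsilon>\<^sup>2}"
    proof (intro measure_pmf.finite_measure_mono subsetI)
      fix X assume "X \<in> {X. \<bar>real (?N X) / real k - a\<bar> > \<epsilon>}"
      then have "\<epsilon>\<^sup>2 \<le> \<bar>real (?N X) / real k - a\<bar>\<^sup>2" using \<open>\<epsilon> > 0\<close> by (intro power_mono) auto
      then show "X \<in> {X. (real (?N X) / real k - a)\<^sup>2 \<ge> \<epsilon>\<^sup>2}" by simp
    qed auto
    also have "\<dots> \<le> measure_pmf.expectation ?P (\<lambda>X. (real (?N X) / real k - a)\<^sup>2) / \<epsilon>\<^sup>2"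
      using \<open>\<epsilon> > 0\<close> by (intro pmf_Markov fin) auto
    also have "\<dots> \<le> 4 * e' / \<epsilon>\<^sup>2" using E by (intro divide_right_mono) auto
    also have "\<dots> = e" using \<open>\<epsilon> > 0\<close> by (simp add: e'_def)
    finally show ?thesis .
  qed
  then show ?thesis by blast
qed

text \<open>After the exchange of sides n1 is the number of columns, hence the lower bound is placed
  on n1.\<close>

lemma right_groupies_concentration:
  fixes p \<epsilon> e :: real and c :: int
  assumes p: "0 < p" "p < 1" and "\<epsilon> > 0" "e > 0"
  defines "a \<equiv> std_normal_cdf (1 - p * real_of_int c / (2 * (1 - p)))"
  shows "\<exists>M. \<forall>n1\<ge>M. \<forall>n2. int n1 - int n2 = c \<longrightarrow>
    measure_pmf.prob (random_bipartite n1 n2 p)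
      {E. \<bar>real (card {v. v < n2 \<and> groupie (bip_verts n1 n2) E (Inr v)}) / real n2 - a\<bar> > \<epsilon>} \<le> e"
proof -
  have "groupie (bip_verts n2 n1) ((`) swap_sides ` E) (Inl v) = groupie (bip_verts n1 n2) E (Inr v)" for n1 n2 E v
    using groupie_image[OF bij_swap_sides, of "bip_verts n1 n2" E "Inr v"]
    by (simp add: swap_sides_bip_verts)
  then have eq: "measure_pmf.prob (random_bipartite n1 n2 p)
      {E. \<bar>real (card {v. v < n2 \<and> groupie (bip_verts n1 n2) E (Inr v)}) / real n2 - a\<bar> > \<epsilon>} =
    measure_pmf.prob (random_bipartite n2 n1 p)
      {E. \<bar>real (card {v. v < n2 \<and> groupie (bip_verts n2 n1) E (Inl v)}) / real n2 - a\<bar> > \<epsilon>}" for n1 n2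
    by (simp add: random_bipartite_swap_sides[of n2 n1])
  have "int n2 - int n1 = - c \<longleftrightarrow> int n1 - int n2 = c" for n1 n2 by linarith
  with left_groupies_concentration[OF p \<open>\<epsilon> > 0\<close> \<open>e > 0\<close>, of "- c"] show ?thesis
    unfolding eq unfolding a_def by simp
qed

lemma num_groupies_bip_verts:
  "num_groupies (bip_verts n1 n2) E =
     card {v. v < n1 \<and> groupie (bip_verts n1 n2) E (Inl v)} + card {v. v < n2 \<and> groupie (bip_verts n1 n2) E (Inr v)}"
proof -
  have "{v \<in> bip_verts n1 n2. groupie (bip_verts n1 n2) E v} =
    {v. v < n1 \<and> groupie (bip_verts n1 n2) E (Inl v)} <+> {v. v < n2 \<and> groupie (bip_verts n1 n2) E (Inr v)}"
    unfolding bip_verts_def by auto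
  then show ?thesis unfolding num_groupies_def by (simp add: card_Plus)
qed

text \<open>The overall proportion is the convex combination of the side proportions with weight u =
  n1 / (n1 + n2), and replacing u by 1/2 costs at most |2 u - 1| since |a - b| / 2 \<le> 1. The
  three errors add up to 3/4 of \<open>\<epsilon>\<close>.\<close>

lemma average_near:
  fixes x y a b n1 n2 \<epsilon> :: real
  assumes "n1 > 0" "n2 > 0" "0 \<le> a" "a \<le> 1" "0 \<le> b" "b \<le> 1"
    and "\<bar>x / n1 - a\<bar> \<le> \<epsilon> / 4" "\<bar>y / n2 - b\<bar> \<le> \<epsilon> / 4" "\<bar>n1 - n2\<bar> / (n1 + n2) \<le> \<epsilon> / 4" "\<epsilon> > 0"
  shows "\<bar>(x + y) / (n1 + n2) - 1/2 * (a + b)\<bar> \<le> \<epsilon>"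
proof -
  let ?n = "n1 + n2"
  define u where "u = n1 / ?n"
  have u: "0 \<le> u" "u \<le> 1" "1 - u = n2 / ?n" "2 * u - 1 = (n1 - n2) / ?n"
    using assms(1,2) by (simp_all add: u_def field_simps)
  have "(x + y) / ?n = u * (x / n1) + (1 - u) * (y / n2)"
    unfolding u(3) using assms(1,2) by (simp add: u_def add_divide_distrib)
  then have "(x + y) / ?n - 1/2 * (a + b) = u * (x / n1 - a) + (1 - u) * (y / n2 - b) + (2 * u - 1) * ((a - b) / 2)"
    by (simp add: algebra_simps diff_divide_distrib add_divide_distrib)
  also have "\<bar>\<dots>\<bar> \<le> \<bar>u * (x / n1 - a)\<bar> + \<bar>(1 - u) * (y / n2 - b)\<bar> + \<bar>(2 * u - 1) * ((a - b) / 2)\<bar>"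
    by linarith
  also have "\<dots> \<le> \<bar>x / n1 - a\<bar> + \<bar>y / n2 - b\<bar> + \<bar>2 * u - 1\<bar>"
  proof -
    have "\<bar>u\<bar> \<le> 1" "\<bar>1 - u\<bar> \<le> 1" "\<bar>(a - b) / 2\<bar> \<le> 1"
      using u(1,2) assms(3-6) by (auto simp: abs_le_iff)
    note bounds = this
    show ?thesis
      unfolding abs_mult by (intro add_mono mult_left_le_one_le mult_left_le abs_ge_zero bounds)
  qed
  also have "\<bar>2 * u - 1\<bar> = \<bar>n1 - n2\<bar> / ?n" unfolding u(4) using assms(1,2) by (simp add: abs_divide)
  finally show ?thesis using assms(7-10) by linarith
qed

theorem theorem6:
  fixes p \<epsilon> :: real and c :: int
  assumes "0 < p" and "p < 1" and "\<epsilon> > 0"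
  shows "((\<lambda>(n1, n2). measure_pmf.prob (random_bipartite n1 n2 p)
            {E. \<bar>real (num_groupies (bip_verts n1 n2) E) / real (n1 + n2)
                 - 1/2 * (std_normal_cdf (1 + p * real_of_int c / (2 * (1 - p)))
                          + std_normal_cdf (1 - p * real_of_int c / (2 * (1 - p))))\<bar> > \<epsilon>})
          \<longlongrightarrow> 0)
         (inf (at_top \<times>\<^sub>F at_top) (principal {(n1, n2). int n1 - int n2 = c}))"
proof (rule tendstoI)
  fix r :: real assume "r > 0"
  define a where "a = std_normal_cdf (1 + p * real_of_int c / (2 * (1 - p)))"
  define b where "b = std_normal_cdf (1 - p * real_of_int c / (2 * (1 - p)))"
  have ab: "0 \<le> a" "a \<le> 1" "0 \<le> b" "b \<le> 1"
    unfolding a_def b_def by (rule std_normal_cdf_bounds)+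
  have pos: "\<epsilon> / 4 > 0" "r / 3 > 0" using \<open>\<epsilon> > 0\<close> \<open>r > 0\<close> by simp_all
  let ?L = "\<lambda>n1 n2. {E. \<bar>real (card {v. v < n1 \<and> groupie (bip_verts n1 n2) E (Inl v)}) / real n1 - a\<bar> > \<epsilon> / 4}"
  let ?R = "\<lambda>n1 n2. {E. \<bar>real (card {v. v < n2 \<and> groupie (bip_verts n1 n2) E (Inr v)}) / real n2 - b\<bar> > \<epsilon> / 4}"
  let ?B = "\<lambda>n1 n2. {E. \<bar>real (num_groupies (bip_verts n1 n2) E) / real (n1 + n2) - 1/2 * (a + b)\<bar> > \<epsilon>}"
  obtain M1 where M1: "\<And>n1 n2. n2 \<ge> M1 \<Longrightarrow> int n1 - int n2 = c \<Longrightarrow>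
      measure_pmf.prob (random_bipartite n1 n2 p) (?L n1 n2) \<le> r / 3"
    using left_groupies_concentration[OF assms(1,2) pos, of c] unfolding a_def by blast
  obtain M2 where M2: "\<And>n1 n2. n1 \<ge> M2 \<Longrightarrow> int n1 - int n2 = c \<Longrightarrow>
      measure_pmf.prob (random_bipartite n1 n2 p) (?R n1 n2) \<le> r / 3"
    using right_groupies_concentration[OF assms(1,2) pos, of c] unfolding b_def by blast
  \<comment> \<open>Makes the relative imbalance |c| / (n1 + n2) at most \<epsilon> / 4.\<close>
  obtain M3 :: nat where M3: "real M3 > \<bar>real_of_int c\<bar> * (4 / \<epsilon>)"
    using reals_Archimedean2 by blast
  have small: "measure_pmf.prob (random_bipartite n1 n2 p) (?B n1 n2) < r"
    if n: "n1 \<ge> M1 + M2 + M3 + 1" "n2 \<ge> M1 + M2 + M3 + 1" and c: "int n1 - int n2 = c" for n1 n2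
  proof -
    have n0: "real n1 > 0" "real n2 > 0" using n by simp_all
    have nc: "real n1 - real n2 = real_of_int c" using c by (metis of_int_diff of_int_of_nat_eq)
    have "real n1 + real n2 \<ge> real M3" using n by simp
    with M3 have "\<bar>real_of_int c\<bar> * (4 / \<epsilon>) \<le> real n1 + real n2" by linarith
    then have cn: "\<bar>real n1 - real n2\<bar> / (real n1 + real n2) \<le> \<epsilon> / 4"
      unfolding nc using n0 \<open>\<epsilon> > 0\<close> by (simp add: field_simps)
    \<comment> \<open>If neither side deviates by more than \<epsilon> / 4, the total cannot deviate
      by more than \<open>\<epsilon>\<close>; a union bound then suffices, without any independence
      between the sides.\<close>
    have "?B n1 n2 \<subseteq> ?L n1 n2 \<union> ?R n1 n2"
    proof (rule subsetI, rule ccontr)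
      fix E assume E: "E \<in> ?B n1 n2" "E \<notin> ?L n1 n2 \<union> ?R n1 n2"
      have "\<bar>real (num_groupies (bip_verts n1 n2) E) / real (n1 + n2) - 1/2 * (a + b)\<bar> \<le> \<epsilon>"
        unfolding num_groupies_bip_verts of_nat_add
        using E(2) by (intro average_near n0 ab cn \<open>\<epsilon> > 0\<close>) (simp_all add: not_less)
      with E(1) show False by simp
    qed
    then have "measure_pmf.prob (random_bipartite n1 n2 p) (?B n1 n2) \<le>
        measure_pmf.prob (random_bipartite n1 n2 p) (?L n1 n2 \<union> ?R n1 n2)"
      by (intro measure_pmf.finite_measure_mono) auto
    also have "\<dots> \<le> measure_pmf.prob (random_bipartite n1 n2 p) (?L n1 n2)
        + measure_pmf.prob (random_bipartite n1 n2 p) (?R n1 n2)"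
      by (rule measure_Un_le) auto
    also have "\<dots> \<le> r / 3 + r / 3"
      using n by (intro add_mono M1 M2 c) simp_all
    also have "\<dots> < r" using \<open>r > 0\<close> by simp
    finally show ?thesis .
  qed
  show "\<forall>\<^sub>F z in inf (at_top \<times>\<^sub>F at_top) (principal {(n1, n2). int n1 - int n2 = c}).
      dist (case z of (n1, n2) \<Rightarrow> measure_pmf.prob (random_bipartite n1 n2 p)
            {E. \<bar>real (num_groupies (bip_verts n1 n2) E) / real (n1 + n2)
                 - 1/2 * (std_normal_cdf (1 + p * real_of_int c / (2 * (1 - p)))
                          + std_normal_cdf (1 - p * real_of_int c / (2 * (1 - p))))\<bar> > \<epsilon>}) 0 < r"
    \<comment> \<open>Eventually in this filter means for all n1 and n2 beyond a common bound that
      lie on the line n1 - n2 = c.\<close>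
    unfolding eventually_inf_principal eventually_prod_sequentially a_def[symmetric] b_def[symmetric]
    by (intro exI[of _ "M1 + M2 + M3 + 1"] allI impI) (use small in \<open>auto simp: dist_real_def\<close>)
qed

end
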